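(* For all positive integers $m$ and $p$, $$\sum_{n=1}^\infty\frac{T_n(\{1\}_{2m-1})\,T_n(\{1\}_{2p-1})}{n}(-1)^n=(-1)^m\sum_{j=1}^pW(2j+2m-1,2m)\,Z(j,p).$$
   Context: $\{1\}_a$ denotes the sequence of $a$ ones. For $n\ge1$, $a\ge1$: $T_n(\{1\}_{2a-1})=\sum\frac{2^{2a-1}}{(2n_1-1)(2n_2)(2n_3-1)\cdots(2n_{2a-2})(2n_{2a-1}-1)}$, summed over integers $0<n_1\le n_2<n_3\le n_4<\cdots\le n_{2a-2}<n_{2a-1}\le n$. For positive integers $k_1,\dots,k_r$, $\bar T(k_1,\ldots,k_r):=2^r\sum_{0<n_1<\cdots<n_r}\frac{(-1)^{n_r}}{(2n_1-1)^{k_1}(2n_2-2)^{k_2}\cdots(2n_r-r)^{k_r}}$. $I(k,r)$ is the set of tuples of positive integers $(k_1,\dots,k_r)$ with sum $k$; $W(k,r):=\sum_{(k_1,\dots,k_r)\in I(k,r)}\bar T(k_1,\dots,k_r)$. $\bar\zeta(s):=\sum_{n\ge1}(-1)^{n-1}n^{-s}$ for $s\ge1$, $\bar\zeta(0):=1/2$. For $1\le j\le p$: $Z(p,p):=1$ and for $j<p$, $Z(j,p):=\sum_{k=1}^{p-j}(-2)^k\sum_{j=i_0<i_1<\cdots<i_k=p}\prod_{l=1}^k\bar\zeta(2i_l-2i_{l-1})$. *)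

theory Defs
  imports Complex_Main
begin

text \<open>T_n({1}_{2a-1}): list ns = [n_1,...,n_{2a-1}] (0-based index i stands for n_{i+1}).
  Constraints: 0 < n_1, n_{odd} \<le> n_{next}, n_{even} < n_{next}, last \<le> n.
  Denominators: 2 n_i - 1 at odd positions, 2 n_i at even positions.\<close>

definition T_chains :: "nat \<Rightarrow> nat \<Rightarrow> nat list set" where
  "T_chains n a = {ns. length ns = 2*a - 1 \<and> (\<forall>i<length ns. 0 < ns!i \<and> ns!i \<le> n) \<and>
      (\<forall>i. Suc i < length ns \<longrightarrow>
          (if even i then ns!i \<le> ns!(Suc i) else ns!i < ns!(Suc i)))}"

definition T_ones :: "nat \<Rightarrow> nat \<Rightarrow> real" where
  "T_ones n a = (\<Sum>ns\<in>T_chains n a.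
      2^(2*a - 1) / (\<Prod>i<length ns. (if even i then 2 * real (ns!i) - 1 else 2 * real (ns!i))))"

definition Tbar_inner :: "nat list \<Rightarrow> nat \<Rightarrow> real" where
  "Tbar_inner ks N = (\<Sum>ns\<in>{ns. length ns = length ks \<and> sorted_wrt (<) ns \<and>
        (\<forall>i<length ns. 0 < ns!i) \<and> ns \<noteq> [] \<and> last ns = N}.
      (-1)^N / (\<Prod>j<length ks. (2 * real (ns!j) - real (Suc j)) ^ (ks!j)))"

definition Tbar :: "nat list \<Rightarrow> real" where
  "Tbar ks = 2^(length ks) * (\<Sum>N. Tbar_inner ks N)"

definition Icomp :: "nat \<Rightarrow> nat \<Rightarrow> nat list set" where
  "Icomp k r = {ks. length ks = r \<and> (\<forall>i<r. 0 < ks!i) \<and> sum_list ks = k}"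

definition W :: "nat \<Rightarrow> nat \<Rightarrow> real" where
  "W k r = (\<Sum>ks\<in>Icomp k r. Tbar ks)"

definition zetabar :: "nat \<Rightarrow> real" where
  "zetabar s = (if s = 0 then 1/2 else (\<Sum>n. (-1)^n / (real (Suc n)) ^ s))"

definition Zchains :: "nat \<Rightarrow> nat \<Rightarrow> nat \<Rightarrow> nat list set" where
  "Zchains k j p = {is. length is = Suc k \<and> sorted_wrt (<) is \<and> is!0 = j \<and> is!k = p}"

definition Z :: "nat \<Rightarrow> nat \<Rightarrow> real" where
  "Z j p = (if j = p then 1 else
     (\<Sum>k=1..p-j. (-2)^k * (\<Sum>is\<in>Zchains k j p.
        (\<Prod>l=1..k. zetabar (2 * (is!l) - 2 * (is!(l-1)))))))"

end

theory Submission
  imports Defs "HOL-Analysis.Analysis" "HOL-Real_Asymp.Real_Asymp"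
begin

text \<open>
  Put \<open>x = (1 - s) / (1 + s)\<close>, so that \<open>2 arctan x = pi / 2 - 2 arctan s\<close> and
  \<open>ln ((1 + x) / (1 - x)) = - ln s\<close>. Both sides are related through the integral
  \<open>\<integral>\<^sub>0\<^sup>1 (- ln s) ^ q / q! * (2 arctan x) ^ r / r! * 2 / (1 + s\<^sup>2) ds\<close> with \<open>q = 2 j - 1\<close>, \<open>r = 2 m - 1\<close>.

  On the one hand, expanding in powers of \<open>s\<close> shows that it equals \<open>W (q + r + 1) (r + 1)\<close>. On the other hand,
  \<open>(2 arctan x) ^ r / r! / (1 + x\<^sup>2)\<close> is, up to sign, the generating function of
  \<open>(-1) ^ n T_n({1}_r)\<close>, and integration by parts gives
  \<open>\<integral>\<^sub>0\<^sup>1 2 n x ^ (2 n - 1) (- ln s) ^ (2 j - 1) / (2 j - 1)! dx = \<Sum>i = 1..j. 2 zetabar (2 j - 2 i) T_n({1}_{2 i - 1})\<close>,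
  because both sides satisfy the recursion by which the sums \<open>T_n\<close> are built up.
  Integrating term by term evaluates \<open>\<Sum>n. (-1) ^ n T_n({1}_r) / n\<close> times the right-hand side. The numbers \<open>Z j p\<close>
  invert the convolution with \<open>2 zetabar\<close>, whose generating function is \<open>pi v / sin (pi v)\<close>.
\<close>

section \<open>Calculus preliminaries\<close>

text \<open>All of \<open>W\<close>, rather than a single \<open>Tbar\<close>, appears because of a
  shuffle. Divided by factorials, the powers of \<open>- ln s\<close> and of
  \<open>pi / 2 - 2 * arctan s\<close> are iterated integrals from \<open>s\<close> to 1 of
  \<open>dt / t\<close> and of \<open>2 dt / (1 + t^2)\<close>. Their product is the sum over all
  words with \<open>q\<close> letters of the first kind and \<open>r\<close> of the second. With the
  innermost factor \<open>2 / (1 + s^2)\<close> these words are exactly the compositions of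
  \<open>q + r + 1\<close> into \<open>r + 1\<close> parts. The obstacle is convergence, which may
  be only conditional. Values at \<open>s = 1\<close> therefore need Abel's theorem, and in the
  termwise integration absolute values would lose an integrable majorant, so partial sums are
  bounded with their signs kept. Chains for \<open>T\<close> and for \<open>Tbar\<close> both become
  strictly increasing chains of alternating parity, so one recursion with \<open>e = 1\<close> or
  \<open>e = -1\<close> serves both.\<close>

lemma has_integral_Ioo_of_limits:
  fixes f f' :: "real \<Rightarrow> real"
  assumes "a < b"
    and der: "\<And>s. s \<in> {a<..<b} \<Longrightarrow> (f has_real_derivative f' s) (at s)"
    and la: "(f \<longlongrightarrow> l) (at_right a)" and lb: "(f \<longlongrightarrow> m) (at_left b)"
  shows "(f' has_integral (m - l)) {a<..<b}"
proof -
  \<comment> \<open>Later antiderivatives may contain \<open>ln s\<close> near 0 and power series at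
    the edge of their disc at 1. Only one-sided limits are known there, and \<open>g\<close> takes
    them as endpoint values.\<close>
  define g where "g = (\<lambda>s. if s = a then l else if s = b then m else f s)"
  have "continuous_on {a..b} g"
  proof (rule continuous_on_IccI)
    have "\<forall>\<^sub>F x in at_right a. g x = f x"
      using eventually_at_right_real[OF \<open>a < b\<close>]
      by (rule eventually_mono) (auto simp: g_def)
    then show "(g \<longlongrightarrow> g a) (at_right a)"
      using la by (simp add: g_def filterlim_cong)
    have "\<forall>\<^sub>F x in at_left b. g x = f x"
      using eventually_at_left_real[OF \<open>a < b\<close>]
      by (rule eventually_mono) (auto simp: g_def)
    moreover have "g b = m"
      using \<open>a < b\<close> by (auto simp: g_def)
    ultimately show "(g \<longlongrightarrow> g b) (at_left b)"
      using lb by (simp add: filterlim_cong)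
  next
    fix x assume x: "a < x" "x < b"
    have "\<forall>\<^sub>F y in at x. y \<in> {a<..<b}"
      using x by (intro eventually_at_in_open') auto
    then have "\<forall>\<^sub>F y in at x. g y = f y"
      by (rule eventually_mono) (auto simp: g_def)
    moreover have "(f \<longlongrightarrow> f x) (at x)"
      using DERIV_isCont[OF der] x by (auto simp: isCont_def)
    ultimately show "(g \<longlongrightarrow> g x) (at x)"
      using x by (simp add: g_def filterlim_cong)
  qed (use \<open>a < b\<close> in auto)
  moreover have "(g has_vector_derivative f' x) (at x)" if x: "x \<in> {a<..<b}" for x
  proof -
    have "(g has_real_derivative f' x) (at x)"
      by (rule has_field_derivative_transform_within_open[OF der[OF x], of "{a<..<b}"])
         (use x in \<open>auto simp: g_def\<close>)
    then show ?thesis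
      by (simp add: has_real_derivative_iff_has_vector_derivative)
  qed
  ultimately have "(f' has_integral (g b - g a)) {a..b}"
    using \<open>a < b\<close> by (intro fundamental_theorem_of_calculus_interior) auto
  then show ?thesis
    using \<open>a < b\<close> by (auto simp: has_integral_Icc_iff_Ioo g_def)
qed

text \<open>Multiplication by \<open>exp (t l)\<close> turns \<open>F' = t u F + G\<close> with \<open>l' = - u\<close> into
  \<open>(exp (t l) F)' = exp (t l) G\<close>; the following is the coefficient of \<open>t ^ q\<close>.\<close>

lemma DERIV_telescoping_sum:
  fixes F :: "nat \<Rightarrow> real \<Rightarrow> real"
  assumes F: "\<And>i. i \<le> q \<Longrightarrow>
      (F i has_real_derivative (if i = 0 then 0 else u * F (i - 1) s) + G i) (at s)"
    and l: "(l has_real_derivative - u) (at s)"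
  shows "((\<lambda>s. \<Sum>i\<le>q. F i s * (l s ^ (q - i) / fact (q - i))) has_real_derivative
          (\<Sum>i\<le>q. G i * (l s ^ (q - i) / fact (q - i)))) (at s)"
proof -
  define P where "P = (\<lambda>j. l s ^ j / fact j)"
  define A where "A = (\<lambda>i. (if i = 0 then 0 else u * F (i - 1) s) * P (q - i))"
  define B where "B = (\<lambda>i. F i s * (- u * (if q - i = 0 then 0 else P (q - i - 1))))"
  have dP: "((\<lambda>s. l s ^ j / fact j) has_real_derivative - u * (if j = 0 then 0 else P (j - 1))) (at s)" for j
  proof (cases j)
    case (Suc k)
    show ?thesis unfolding Suc P_def
      by (rule derivative_eq_intros l refl | simp add: field_simps del: of_nat_Suc)+
  qed simp
  have "((\<lambda>s. \<Sum>i\<le>q. F i s * (l s ^ (q - i) / fact (q - i))) has_real_derivative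
          (\<Sum>i\<le>q. F i s * (- u * (if q - i = 0 then 0 else P (q - i - 1)))
              + ((if i = 0 then 0 else u * F (i - 1) s) + G i) * P (q - i))) (at s)"
  proof (rule DERIV_sum)
    fix i assume "i \<in> {..q}"
    then show "((\<lambda>s. F i s * (l s ^ (q - i) / fact (q - i))) has_real_derivative
        F i s * (- u * (if q - i = 0 then 0 else P (q - i - 1)))
              + ((if i = 0 then 0 else u * F (i - 1) s) + G i) * P (q - i)) (at s)"
      using DERIV_mult'[OF F[of i] dP[of "q - i"]] by (simp add: P_def)
  qed
  also have "(\<Sum>i\<le>q. F i s * (- u * (if q - i = 0 then 0 else P (q - i - 1)))
              + ((if i = 0 then 0 else u * F (i - 1) s) + G i) * P (q - i))
      = sum B {..q} + sum A {..q} + (\<Sum>i\<le>q. G i * P (q - i))"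
    unfolding sum.distrib[symmetric]
    by (rule sum.cong) (simp_all add: A_def B_def algebra_simps)
  \<comment> \<open>The term \<open>i = 0\<close> of \<open>A\<close> and the term
    \<open>i = q\<close> of \<open>B\<close> vanish; after an index shift in \<open>A\<close> the
    two sums are opposite.\<close>
  also have "sum A {..q} = (\<Sum>i<q. u * F i s * P (q - Suc i))"
    by (simp add: sum.atMost_shift A_def)
  also have "sum B {..q} = (\<Sum>i<q. - (u * F i s * P (q - Suc i)))"
    by (simp add: lessThan_Suc_atMost[symmetric] B_def) (rule sum.cong, auto)
  finally show ?thesis
    by (simp add: P_def sum_negf)
qed

text \<open>Summation by parts turns the difference to the limit into
  \<open>(1 - x) * (\<Sum>k. d k * x ^ k)\<close>, where \<open>d k\<close> is the error of the
  partial sum. The factor \<open>1 - x\<close> kills any initial segment, and the smallness of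
  \<open>d\<close> controls the tail.\<close>

lemma Abel_limit:
  fixes a :: "nat \<Rightarrow> real"
  assumes "summable a"
  shows "((\<lambda>x. \<Sum>k. a k * x ^ k) \<longlongrightarrow> suminf a) (at_left 1)"
proof -
  define S where "S = suminf a"
  define d where "d = (\<lambda>n. (\<Sum>k\<le>n. a k) - S)"
  have d0: "d \<longlonglongrightarrow> 0"
    unfolding d_def S_def using summable_LIMSEQ'[OF assms] LIM_zero by blast
  then obtain M where M: "\<And>n. \<bar>d n\<bar> \<le> M"
    using convergent_imp_Bseq[of d] by (auto simp: convergent_def Bseq_def)
  have sd: "summable (\<lambda>k. d k * x ^ k)" "summable (\<lambda>k. \<bar>d k * x ^ k\<bar>)" if "0 < x" "x < 1" for x
  proof -
    have "summable (\<lambda>k. M * x ^ k)"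
      using that by (intro summable_mult summable_geometric) auto
    then show "summable (\<lambda>k. \<bar>d k * x ^ k\<bar>)"
      by (rule summable_comparison_test'[where N=0]) (use that M in \<open>auto simp: abs_mult intro!: mult_right_mono\<close>)
    then show "summable (\<lambda>k. d k * x ^ k)" by (rule summable_rabs_cancel)
  qed
  have eq: "(\<Sum>k. a k * x ^ k) - S = (1 - x) * (\<Sum>k. d k * x ^ k)" if x: "0 < x" "x < 1" for x
  proof -
    have s2: "(\<lambda>k. d k * x ^ k) sums (\<Sum>k. d k * x ^ k)"
      using sd x by (simp add: summable_sums)
    have s1: "(\<lambda>k. (if k = 0 then 0 else d (k - 1)) * x ^ k) sums (x * (\<Sum>k. d k * x ^ k))"
      using sums_mult[OF s2, of x]
        sums_Suc[where f="\<lambda>k. (if k = 0 then 0 else d (k - 1)) * x ^ k" and l="x * (\<Sum>k. d k * x ^ k)"]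
      by (simp add: mult_ac)
    have "(\<lambda>k. d k * x ^ k - (if k = 0 then 0 else d (k - 1)) * x ^ k) sums
            ((\<Sum>k. d k * x ^ k) - x * (\<Sum>k. d k * x ^ k))"
      by (rule sums_diff[OF s2 s1])
    \<comment> \<open>\<open>d k - d (k - 1) = a k\<close> for positive \<open>k\<close>, but
      \<open>d 0 = a 0 - S\<close>; hence the correction at \<open>k = 0\<close>.\<close>
    moreover have "d k * x ^ k - (if k = 0 then 0 else d (k - 1)) * x ^ k
        = a k * x ^ k - (if k = 0 then S else 0)" for k
      by (cases k) (simp_all add: d_def algebra_simps)
    ultimately have "(\<lambda>k. a k * x ^ k - (if k = 0 then S else 0)) sums
            ((\<Sum>k. d k * x ^ k) - x * (\<Sum>k. d k * x ^ k))" by simp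
    from sums_add[OF this sums_single[of 0 "\<lambda>_. S"]]
    have "(\<lambda>k. a k * x ^ k) sums ((\<Sum>k. d k * x ^ k) - x * (\<Sum>k. d k * x ^ k) + S)" by simp
    then show ?thesis by (simp add: sums_iff algebra_simps)
  qed
  have "((\<lambda>x. (\<Sum>k. a k * x ^ k) - S) \<longlongrightarrow> 0) (at_left 1)"
  proof (rule tendstoI)
    fix e :: real assume "e > 0"
    then obtain K where K: "\<And>n. n \<ge> K \<Longrightarrow> \<bar>d n\<bar> < e / 2"
      using d0[THEN LIMSEQ_D, of "e/2"] by auto
    have "((\<lambda>x. (1 - x) * (real K * M)) \<longlongrightarrow> (1 - 1) * (real K * M)) (at_left 1)"
      by (intro tendsto_intros)
    then have "\<forall>\<^sub>F x in at_left 1. (1 - x) * (real K * M) < e / 2"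
      using \<open>e > 0\<close> by (intro order_tendstoD) auto
    moreover have "\<forall>\<^sub>F x in at_left 1. x \<in> {0<..<1::real}"
      using eventually_at_left_real[of 0 1] by simp
    ultimately show "\<forall>\<^sub>F x in at_left 1. dist ((\<Sum>k. a k * x ^ k) - S) 0 < e"
    proof eventually_elim
      case (elim x)
      then have x: "0 < x" "x < 1" by auto
      have "\<bar>\<Sum>k. d k * x ^ k\<bar> \<le> (\<Sum>k. \<bar>d k * x ^ k\<bar>)"
        by (rule summable_rabs[OF sd(2)[OF x]])
      also have "\<dots> = (\<Sum>k<K. \<bar>d k * x ^ k\<bar>) + (\<Sum>k. \<bar>d (k + K) * x ^ (k + K)\<bar>)"
        using suminf_split_initial_segment[OF sd(2)[OF x], of K] by simp
      also have "(\<Sum>k<K. \<bar>d k * x ^ k\<bar>) \<le> (\<Sum>k<K. M * 1)"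
      proof (rule sum_mono)
        fix k
        have "\<bar>d k\<bar> * x ^ k \<le> M * 1"
          using x M[of k] by (intro mult_mono power_le_one zero_le_power) linarith+
        then show "\<bar>d k * x ^ k\<bar> \<le> M * 1" using x by (simp add: abs_mult)
      qed
      also have "(\<Sum>k. \<bar>d (k + K) * x ^ (k + K)\<bar>) \<le> (\<Sum>k. e / 2 * x ^ k)"
      proof (rule suminf_le)
        show "summable (\<lambda>k. \<bar>d (k + K) * x ^ (k + K)\<bar>)"
          using sd(2)[OF x] summable_iff_shift[of "\<lambda>k. \<bar>d k * x ^ k\<bar>" K] by simp
        show "summable (\<lambda>k. e / 2 * x ^ k)"
          using x by (intro summable_mult summable_geometric) auto
        fix k
        have "x ^ (k + K) \<le> x ^ k"
          using x by (intro power_decreasing) auto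
        then have "\<bar>d (k + K)\<bar> * x ^ (k + K) \<le> e / 2 * x ^ k"
          using x K[of "k + K"] \<open>e > 0\<close> by (intro mult_mono zero_le_power) auto
        then show "\<bar>d (k + K) * x ^ (k + K)\<bar> \<le> e / 2 * x ^ k"
          using x by (simp add: abs_mult)
      qed
      also have "\<dots> = e / 2 / (1 - x)"
        using x by (subst suminf_mult) (auto simp: suminf_geometric summable_geometric)
      finally have "\<bar>\<Sum>k. d k * x ^ k\<bar> \<le> real K * M + e / 2 / (1 - x)" by simp
      then have "(1 - x) * \<bar>\<Sum>k. d k * x ^ k\<bar> \<le> (1 - x) * (real K * M + e / 2 / (1 - x))"
        using x by (intro mult_left_mono) auto
      also have "\<dots> = (1 - x) * (real K * M) + e / 2"
        using x by (simp add: field_simps)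
      also have "\<dots> < e" using elim by simp
      finally show ?case using x by (simp add: eq abs_mult)
    qed
  qed
  then show ?thesis unfolding S_def by (rule LIM_zero_cancel)
qed

lemma tendsto_mult_ln_power_at_right_0:
  "((\<lambda>s::real. s * (- ln s) ^ n) \<longlongrightarrow> 0) (at_right 0)"
  by real_asymp

section \<open>Nested sums and their generating functions\<close>

fun csum :: "real \<Rightarrow> (nat \<Rightarrow> real) \<Rightarrow> nat \<Rightarrow> real" where
  "csum e a 0 = a 0"
| "csum e a (Suc 0) = a 1"
| "csum e a (Suc (Suc k)) = e * csum e a k + a (Suc (Suc k))"

text \<open>\<open>csum e a\<close> is the coefficient sequence of \<open>A(x) / (1 - e x\<^sup>2)\<close> where \<open>A\<close> is that of \<open>a\<close>.
  With \<open>N\<^sub>j = 2 n\<^sub>j - j\<close>, the chains defining \<open>Tbar [c\<^sub>1, \<dots>, c\<^sub>r]\<close> become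
  \<open>0 < N\<^sub>1 < \<dots> < N\<^sub>r\<close> with \<open>N\<^sub>j\<close> of the parity of \<open>j\<close>, and \<open>nest 1 [c\<^sub>r, \<dots>, c\<^sub>1] k\<close> is the sum of
  \<open>\<Prod>j. 2 / N\<^sub>j ^ c\<^sub>j\<close> over those with \<open>N\<^sub>r = k\<close> (note the reversed list).
  The choice \<open>e = -1\<close> inserts the sign \<open>(-1) ^ ((k - r) / 2)\<close>.\<close>

primrec nest :: "real \<Rightarrow> nat list \<Rightarrow> nat \<Rightarrow> real" where
  "nest e [] = (\<lambda>k. if k = 0 then 1 else 0)"
| "nest e (c # cs) = (\<lambda>k. if k = 0 then 0 else 2 * csum e (nest e cs) (k - 1) / real k ^ c)"

lemma nest_Cons_Suc: "nest e (c # cs) (Suc k) = 2 * csum e (nest e cs) k / real (Suc k) ^ c"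
  by simp

lemma csum_sum: "csum e (\<lambda>k. \<Sum>i\<in>A. a i k) k = (\<Sum>i\<in>A. csum e (a i) k)"
  by (induction k rule: induct_nat_012) (simp_all add: sum_distrib_left sum.distrib)

text \<open>One step of the recursion adds at most \<open>C / v\<close>, and
  \<open>v * v = u * u + 2\<close> with \<open>2 * u * v \<le> u * u + v * v\<close> gives
  \<open>u + 1 / v \<le> v\<close>. No cancellation is used, so this covers both signs of
  \<open>e\<close>.\<close>

lemma csum_abs_le:
  assumes "\<bar>e\<bar> \<le> 1" "0 \<le> C" and a: "\<And>k. \<bar>a k\<bar> \<le> C / sqrt (real (Suc k))"
  shows "\<bar>csum e a k\<bar> \<le> C * sqrt (real (Suc k))"
proof (induction k rule: induct_nat_012)
  case 1
  have "C / sqrt 2 \<le> C * sqrt 2"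
    using \<open>0 \<le> C\<close> by (simp add: field_simps)
  then show ?case using a[of 1] by simp
next
  case (ge2 k)
  define u v where "u = sqrt (real (Suc k))" and "v = sqrt (real (Suc (Suc (Suc k))))"
  have uv: "0 < u" "u \<le> v" "v * v = u * u + 2"
    by (simp_all add: u_def v_def)
  have "u * v + 1 \<le> v * v"
  proof -
    have "2 * (u * v) \<le> u * u + v * v"
      using sum_squares_bound[of u v] by (simp add: power2_eq_square algebra_simps)
    then show ?thesis using uv by simp
  qed
  then have "u + 1 / v \<le> v"
    using uv by (simp add: field_simps)
  have "\<bar>e * csum e a k\<bar> \<le> 1 * (C * u)"
    unfolding abs_mult using ge2(1) assms by (intro mult_mono) (auto simp: u_def)
  moreover have "\<bar>a (Suc (Suc k))\<bar> \<le> C / v"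
    using a[of "Suc (Suc k)"] by (simp add: v_def)
  ultimately have "\<bar>csum e a (Suc (Suc k))\<bar> \<le> C * (u + 1 / v)"
    by (simp add: algebra_simps)
  also have "\<dots> \<le> C * v"
    using \<open>u + 1 / v \<le> v\<close> \<open>0 \<le> C\<close> by (rule mult_left_mono)
  finally show ?case by (simp add: v_def)
qed (use a[of 0] in simp)

text \<open>Summation raises the decay to \<open>sqrt k\<close>, and division by at least
  \<open>k\<close> restores it. Each entry costs a factor 4: 2 from the definition and 2 from
  comparing \<open>sqrt k\<close> with \<open>sqrt (Suc k)\<close>.\<close>

lemma nest_abs_le:
  assumes "\<bar>e\<bar> \<le> 1" "\<forall>c\<in>set cs. 0 < c"
  shows "\<bar>nest e cs k\<bar> \<le> 4 ^ length cs / sqrt (real (Suc k))"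
  using assms(2)
proof (induction cs arbitrary: k)
  case (Cons c cs)
  show ?case
  proof (cases k)
    case (Suc j)
    define u where "u = sqrt (real (Suc j))"
    have u: "0 < u" "u * u = real (Suc j)" by (simp_all add: u_def)
    have c: "\<bar>csum e (nest e cs) j\<bar> \<le> 4 ^ length cs * u"
      unfolding u_def using Cons assms by (intro csum_abs_le) auto
    have "real (Suc j) ^ 1 \<le> real (Suc j) ^ c"
      using Cons.prems by (intro power_increasing) auto
    then have "\<bar>nest e (c # cs) k\<bar> \<le> 2 * \<bar>csum e (nest e cs) j\<bar> / real (Suc j)"
      unfolding Suc nest_Cons_Suc abs_divide abs_mult by (intro frac_le) auto
    also have "\<dots> \<le> 2 * (4 ^ length cs * u) / real (Suc j)"
      using c by (intro divide_right_mono mult_left_mono) auto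
    also have "\<dots> = 2 * 4 ^ length cs / u"
      using u(1) by (simp add: u(2)[symmetric] field_simps del: of_nat_Suc)
    also have "\<dots> \<le> 4 * 4 ^ length cs / sqrt (real (Suc k))"
    proof -
      have "sqrt (real (Suc k)) \<le> sqrt (4 * real (Suc j))"
        by (simp add: Suc)
      also have "\<dots> = 2 * u" by (simp only: u_def real_sqrt_mult) simp
      finally have "1 / (2 * u) \<le> 1 / sqrt (real (Suc k))"
        using u by (intro divide_left_mono) auto
      then show ?thesis using mult_left_mono[of "1 / (2 * u)" "1 / sqrt (real (Suc k))" "4 * 4 ^ length cs"]
        by simp
    qed
    finally show ?thesis by simp
  qed simp
qed simp

section \<open>Power series with coefficients of root decay\<close>

lemma summable_powser_of_bounded:
  fixes a :: "nat \<Rightarrow> real"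
  assumes "\<And>k. \<bar>a k\<bar> \<le> C * real (Suc k)" "\<bar>x\<bar> < 1"
  shows "summable (\<lambda>k. a k * x ^ k)"
proof -
  \<comment> \<open>The differentiated geometric series, with coefficients
    \<open>real (Suc k)\<close>.\<close>
  have "summable (\<lambda>k. diffs (\<lambda>_. 1) k * \<bar>x\<bar> ^ k :: real)"
    using assms(2) by (intro termdiff_converges[where K=1]) (auto simp: summable_geometric)
  then have "summable (\<lambda>k. C * (real (Suc k) * \<bar>x\<bar> ^ k))"
    by (intro summable_mult) (simp add: diffs_def)
  then show ?thesis
    by (rule summable_comparison_test'[where N=0])
       (use assms(1) in \<open>auto simp: abs_mult power_abs mult.assoc[symmetric] simp del: of_nat_Suc intro!: mult_right_mono\<close>)
qed

definition ps :: "(nat \<Rightarrow> real) \<Rightarrow> real \<Rightarrow> real" where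
  "ps a x = (\<Sum>k. a k * x ^ k)"

text \<open>The coefficients that occur are of size \<open>(ln k) ^ r / k\<close>; the crude bound \<open>1 / sqrt k\<close> is
  stable under the recursion for \<open>nest\<close> and suffices for all convergence questions.\<close>

definition root_decay :: "(nat \<Rightarrow> real) \<Rightarrow> bool" where
  "root_decay a \<longleftrightarrow> (\<exists>C\<ge>0. \<forall>k. \<bar>a k\<bar> \<le> C / sqrt (real (Suc k)))"

lemma root_decay_nest: "\<bar>e\<bar> \<le> 1 \<Longrightarrow> \<forall>c\<in>set cs. 0 < c \<Longrightarrow> root_decay (nest e cs)"
  unfolding root_decay_def using nest_abs_le[of e cs] by (intro exI[of _ "4 ^ length cs"]) auto

lemma root_decay_sum:
  assumes "\<And>i. i \<in> A \<Longrightarrow> root_decay (a i)"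
  shows "root_decay (\<lambda>k. \<Sum>i\<in>A. a i k)"
proof -
  obtain C where C: "\<And>i. i \<in> A \<Longrightarrow> 0 \<le> C i" "\<And>i k. i \<in> A \<Longrightarrow> \<bar>a i k\<bar> \<le> C i / sqrt (real (Suc k))"
    using assms unfolding root_decay_def by metis
  have "\<bar>\<Sum>i\<in>A. a i k\<bar> \<le> (\<Sum>i\<in>A. C i) / sqrt (real (Suc k))" for k
    unfolding sum_divide_distrib by (rule order_trans[OF sum_abs sum_mono]) (use C in auto)
  then show ?thesis
    unfolding root_decay_def using C by (intro exI[of _ "\<Sum>i\<in>A. C i"]) (auto intro: sum_nonneg)
qed

lemma root_decay_bounded:
  assumes "root_decay a"
  obtains C where "0 \<le> C" "\<And>k. \<bar>a k\<bar> \<le> C" "\<And>k. \<bar>a k\<bar> \<le> C * real (Suc k)"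
proof -
  obtain C where C: "0 \<le> C" "\<And>k. \<bar>a k\<bar> \<le> C / sqrt (real (Suc k))"
    using assms unfolding root_decay_def by auto
  have 1: "\<bar>a k\<bar> \<le> C" for k
  proof -
    have "C / sqrt (real (Suc k)) \<le> C / 1"
      using C by (intro divide_left_mono) auto
    then show ?thesis using C(2)[of k] by simp
  qed
  moreover have "\<bar>a k\<bar> \<le> C * real (Suc k)" for k
  proof -
    have "C * 1 \<le> C * real (Suc k)"
      using C by (intro mult_left_mono) auto
    then show ?thesis using 1[of k] by simp
  qed
  ultimately show ?thesis using that C by blast
qed

lemma summable_ps:
  assumes "root_decay a" "\<bar>x\<bar> < 1"
  shows "summable (\<lambda>k. a k * x ^ k)"
  using root_decay_bounded[OF assms(1)] summable_powser_of_bounded assms(2) by metis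

lemma DERIV_ps:
  assumes "root_decay a" "\<bar>x\<bar> < 1"
  shows "(ps a has_real_derivative ps (diffs a) x) (at x)"
  unfolding ps_def
  by (rule termdiffs_strong'[where K=1]) (use assms summable_ps in auto)

lemma summable_csum:
  assumes "root_decay a" "\<bar>e\<bar> \<le> 1" "\<bar>x\<bar> < 1"
  shows "summable (\<lambda>k. csum e a k * x ^ k)"
proof -
  obtain C where C: "0 \<le> C" "\<And>k. \<bar>a k\<bar> \<le> C / sqrt (real (Suc k))"
    using assms unfolding root_decay_def by auto
  have "\<bar>csum e a k\<bar> \<le> C * real (Suc k)" for k
  proof -
    have "sqrt (real (Suc k)) \<le> sqrt (real (Suc k) ^ 2)"
      by (intro real_sqrt_le_mono) (simp add: power2_eq_square)
    then have "C * sqrt (real (Suc k)) \<le> C * real (Suc k)"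
      using C(1) by (intro mult_left_mono) auto
    then show ?thesis using csum_abs_le[OF assms(2) C, of k] by simp
  qed
  then show ?thesis using summable_powser_of_bounded assms(3) by blast
qed

lemma ps_csum:
  assumes "root_decay a" "\<bar>e\<bar> \<le> 1" "\<bar>x\<bar> < 1"
  shows "(1 - e * x\<^sup>2) * ps (csum e a) x = ps a x"
proof -
  note S = summable_csum[OF assms] and s = summable_ps[OF assms(1,3)]
  have "ps (csum e a) x = (\<Sum>k. csum e a (k + 2) * x ^ (k + 2)) + (a 0 + a 1 * x)"
    unfolding ps_def using suminf_split_initial_segment[OF S, of 2]
    by (simp add: numeral_2_eq_2)
  moreover have "(\<Sum>k. csum e a (k + 2) * x ^ (k + 2)) =
      (\<Sum>k. e * x\<^sup>2 * (csum e a k * x ^ k) + a (k + 2) * x ^ (k + 2))"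
    by (simp add: power2_eq_square algebra_simps)
  moreover have "\<dots> = e * x\<^sup>2 * ps (csum e a) x + (\<Sum>k. a (k + 2) * x ^ (k + 2))"
    unfolding ps_def using S s summable_iff_shift[of "\<lambda>k. a k * x ^ k" 2]
    by (subst suminf_add[symmetric]) (auto simp: suminf_mult intro: summable_mult)
  moreover have "(\<Sum>k. a (k + 2) * x ^ (k + 2)) = ps a x - (a 0 + a 1 * x)"
    unfolding ps_def using suminf_split_initial_segment[OF s, of 2]
    by (simp add: numeral_2_eq_2)
  ultimately have "ps (csum e a) x = e * x\<^sup>2 * ps (csum e a) x + ps a x" by linarith
  then show ?thesis by (simp add: left_diff_distrib)
qed

lemma one_minus_mult_square_pos: "\<bar>e\<bar> \<le> 1 \<Longrightarrow> \<bar>x\<bar> < 1 \<Longrightarrow> 0 < 1 - e * x\<^sup>2" for e x :: real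
proof -
  assume "\<bar>e\<bar> \<le> 1" "\<bar>x\<bar> < 1"
  then have "\<bar>e\<bar> * x\<^sup>2 \<le> 1 * x\<^sup>2" "x\<^sup>2 < 1"
    using mult_right_mono[of "\<bar>e\<bar>" 1 "x\<^sup>2"] by (auto simp: abs_square_less_1)
  then have "\<bar>e * x\<^sup>2\<bar> < 1" by (simp add: abs_mult)
  then show ?thesis by linarith
qed

text \<open>By induction both sides have the same derivative, and for positive \<open>r\<close> both
  vanish at 0. Leaving \<open>h\<close> abstract covers \<open>ln (1 + x) - ln (1 - x)\<close> for
  \<open>e = 1\<close> and \<open>2 * arctan x\<close> for \<open>e = -1\<close>.\<close>

lemma ps_nest_replicate:
  assumes e: "\<bar>e\<bar> \<le> 1" and h0: "h 0 = 0"
    and h: "\<And>x. \<bar>x\<bar> < 1 \<Longrightarrow> (h has_real_derivative 2 / (1 - e * x\<^sup>2)) (at x)"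
    and x: "\<bar>x\<bar> < 1"
  shows "ps (nest e (replicate r 1)) x = h x ^ r / fact r"
  using x
proof (induction r arbitrary: x)
  case 0
  have "(\<lambda>k. nest e [] k * x ^ k) sums 1"
    using sums_single[of 0 "\<lambda>_. 1::real"] by (rule sums_cong[THEN iffD1, rotated]) auto
  then show ?case by (simp add: ps_def sums_iff)
next
  case (Suc r)
  let ?f = "\<lambda>x. ps (nest e (replicate (Suc r) 1)) x - h x ^ Suc r / fact (Suc r)"
  have rd: "root_decay (nest e (replicate n 1))" for n
    using e by (intro root_decay_nest) auto
  have d: "(?f has_real_derivative 0) (at y)" if y: "\<bar>y\<bar> < 1" for y
  proof -
    have "diffs (nest e (replicate (Suc r) 1)) = (\<lambda>k. 2 * csum e (nest e (replicate r 1)) k)"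
      by (auto simp: diffs_def simp del: of_nat_Suc)
    then have "ps (diffs (nest e (replicate (Suc r) 1))) y = 2 * ps (csum e (nest e (replicate r 1))) y"
      unfolding ps_def using summable_csum[OF rd e y, of r]
      by (simp add: suminf_mult mult.assoc)
    also have "\<dots> = 2 / (1 - e * y\<^sup>2) * (h y ^ r / fact r)"
    proof -
      have "ps (csum e (nest e (replicate r 1))) y = h y ^ r / fact r / (1 - e * y\<^sup>2)"
        using ps_csum[OF rd e y, of r] Suc.IH[OF y] one_minus_mult_square_pos[OF e y]
        by (metis less_irrefl nonzero_mult_div_cancel_left)
      then show ?thesis by simp
    qed
    finally have "(ps (nest e (replicate (Suc r) 1)) has_real_derivative
        2 / (1 - e * y\<^sup>2) * (h y ^ r / fact r)) (at y)"
      using DERIV_ps[OF rd y, of "Suc r"] by simp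
    moreover have "((\<lambda>x. h x ^ Suc r / fact (Suc r)) has_real_derivative
        2 / (1 - e * y\<^sup>2) * (h y ^ r / fact r)) (at y)"
      using DERIV_cdivide[OF DERIV_power[OF h[OF y], of "Suc r"], of "fact (Suc r)"]
      by (simp add: mult.assoc del: of_nat_Suc power_Suc)
    ultimately show ?thesis using DERIV_diff by fastforce
  qed
  have "\<exists>c. \<forall>y\<in>ball 0 1. ?f y = c"
    by (rule has_field_derivative_zero_constant[OF convex_ball has_field_derivative_at_within[OF d]]) simp
  then obtain c where c: "\<And>y. y \<in> ball 0 1 \<Longrightarrow> ?f y = c" by blast
  have "ps (nest e (replicate (Suc r) 1)) 0 = 0"
    unfolding ps_def by (simp only: powser_zero) simp
  then have "?f 0 = 0" using h0 by simp
  with c[of 0] c[of x] Suc.prems show ?case by simp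
qed

section \<open>Sums over compositions as an integral\<close>

lemma Icomp_iff: "cs \<in> Icomp n r \<longleftrightarrow> length cs = r \<and> (\<forall>c\<in>set cs. 0 < c) \<and> sum_list cs = n"
  by (auto simp: Icomp_def all_set_conv_all_nth)

lemma finite_Icomp: "finite (Icomp n r)"
proof (rule finite_subset)
  show "Icomp n r \<subseteq> {cs. set cs \<subseteq> {..n} \<and> length cs = r}"
    by (auto simp: Icomp_iff member_le_sum_list)
qed (rule finite_lists_length_eq, simp)

lemma Icomp_0_right: "Icomp n 0 = (if n = 0 then {[]} else {})"
  by (auto simp: Icomp_iff)

lemma Icomp_eq_empty: "n < r \<Longrightarrow> Icomp n r = {}"
proof -
  have "length cs \<le> sum_list cs" if "\<forall>c\<in>set cs. 0 < c" for cs :: "nat list"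
    using that by (induction cs) auto
  then show "n < r \<Longrightarrow> Icomp n r = {}" by (fastforce simp: Icomp_iff)
qed

text \<open>A head 1 is removed, a larger head is lowered by one. These alternatives become the two
  terms of the differential equation for \<open>nest_comp\<close>.\<close>

lemma Icomp_Suc_Suc:
  "Icomp (Suc n) (Suc r) =
     (#) 1 ` Icomp n r \<union> (\<lambda>cs. Suc (hd cs) # tl cs) ` Icomp n (Suc r)"
proof (intro equalityI subsetI)
  fix cs assume cs: "cs \<in> Icomp (Suc n) (Suc r)"
  then obtain c ds where [simp]: "cs = Suc c # ds"
    by (cases cs; cases "hd cs") (auto simp: Icomp_iff)
  show "cs \<in> (#) 1 ` Icomp n r \<union> (\<lambda>cs. Suc (hd cs) # tl cs) ` Icomp n (Suc r)"
  proof (cases c)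
    case (Suc d)
    then have "c # ds \<in> Icomp n (Suc r)" using cs by (auto simp: Icomp_iff)
    then show ?thesis by force
  qed (use cs in \<open>auto simp: Icomp_iff\<close>)
next
  fix cs assume "cs \<in> (#) 1 ` Icomp n r \<union> (\<lambda>cs. Suc (hd cs) # tl cs) ` Icomp n (Suc r)"
  then show "cs \<in> Icomp (Suc n) (Suc r)"
  proof
    assume "cs \<in> (\<lambda>cs. Suc (hd cs) # tl cs) ` Icomp n (Suc r)"
    then obtain ds where "ds \<in> Icomp n (Suc r)" "cs = Suc (hd ds) # tl ds" by auto
    then show ?thesis by (cases ds) (auto simp: Icomp_iff)
  qed (auto simp: Icomp_iff)
qed

definition nest_comp :: "real \<Rightarrow> nat \<Rightarrow> nat \<Rightarrow> nat \<Rightarrow> real" where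
  "nest_comp e r n k = (\<Sum>cs\<in>Icomp n r. nest e cs k)"

lemma root_decay_nest_comp: "\<bar>e\<bar> \<le> 1 \<Longrightarrow> root_decay (nest_comp e r n)"
  unfolding nest_comp_def by (intro root_decay_sum root_decay_nest) (auto simp: Icomp_iff)

lemma nest_comp_Suc_0: "nest_comp e (Suc r) n 0 = 0"
  unfolding nest_comp_def by (intro sum.neutral) (auto simp: Icomp_iff length_Suc_conv)

text \<open>The factor \<open>Suc k\<close> cancels one power in the head exponent: a head 1
  disappears and leaves \<open>2 * csum\<close>, a larger head drops by one.\<close>

lemma nest_comp_Suc:
  "real (Suc k) * nest_comp e (Suc r) (Suc n) (Suc k) =
     nest_comp e (Suc r) n (Suc k) + 2 * csum e (nest_comp e r n) k"
proof -
  let ?g = "\<lambda>cs::nat list. Suc (hd cs) # tl cs"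
  have inj: "inj_on ?g (Icomp n (Suc r))"
  proof (rule inj_onI)
    fix cs ds assume "cs \<in> Icomp n (Suc r)" "ds \<in> Icomp n (Suc r)" "?g cs = ?g ds"
    then show "cs = ds" by (cases cs; cases ds) (auto simp: Icomp_iff)
  qed
  have disj: "(#) 1 ` Icomp n r \<inter> ?g ` Icomp n (Suc r) = {}"
  proof -
    have "hd cs > 0" if "cs \<in> Icomp n (Suc r)" for cs
      using that by (cases cs) (auto simp: Icomp_iff)
    then show ?thesis by fastforce
  qed
  have "nest_comp e (Suc r) (Suc n) (Suc k) =
     (\<Sum>cs\<in>Icomp n r. nest e (1 # cs) (Suc k)) + (\<Sum>cs\<in>Icomp n (Suc r). nest e (?g cs) (Suc k))"
    unfolding nest_comp_def Icomp_Suc_Suc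
    by (subst sum.union_disjoint)
       (use disj inj in \<open>auto simp: finite_Icomp sum.reindex o_def simp del: nest.simps\<close>)
  moreover have "real (Suc k) * (\<Sum>cs\<in>Icomp n r. nest e (1 # cs) (Suc k)) = 2 * csum e (nest_comp e r n) k"
    unfolding nest_comp_def csum_sum sum_distrib_left
    by (rule sum.cong) (simp_all del: of_nat_Suc)
  moreover have "real (Suc k) * (\<Sum>cs\<in>Icomp n (Suc r). nest e (?g cs) (Suc k)) = nest_comp e (Suc r) n (Suc k)"
    unfolding nest_comp_def sum_distrib_left
  proof (rule sum.cong)
    fix cs assume "cs \<in> Icomp n (Suc r)"
    then obtain c ds where "cs = c # ds" by (cases cs) (auto simp: Icomp_iff)
    then show "real (Suc k) * nest e (?g cs) (Suc k) = nest e cs (Suc k)"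
      by (simp del: of_nat_Suc)
  qed simp
  ultimately show ?thesis by (simp only: distrib_left)
qed

section \<open>Conditional convergence of the alternating nested series\<close>

lemma summable_root_decay_div:
  assumes "root_decay b"
  shows "summable (\<lambda>k. b k / real (Suc k))"
proof -
  obtain C where C: "0 \<le> C" "\<And>k. \<bar>b k\<bar> \<le> C / sqrt (real (Suc k))"
    using assms unfolding root_decay_def by auto
  have "summable (\<lambda>k. real k powr (- 3/2))"
    by (simp add: summable_real_powr_iff)
  then have s: "summable (\<lambda>k. C * real (Suc k) powr (- 3/2))"
    by (intro summable_mult) (simp only: summable_Suc_iff[of "\<lambda>k. real k powr (- 3/2)"])
  show ?thesis
  proof (rule summable_comparison_test'[OF s, where N=0])
    fix k
    have "norm (b k / real (Suc k)) = \<bar>b k\<bar> / real (Suc k)" by simp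
    also have "\<dots> \<le> C / sqrt (real (Suc k)) / real (Suc k)"
      by (intro divide_right_mono C) simp
    also have "C / sqrt (real (Suc k)) / real (Suc k) = C * real (Suc k) powr (- 3/2)"
    proof -
      have "sqrt (real (Suc k)) * real (Suc k) = real (Suc k) powr (3/2)"
        using powr_add[of "real (Suc k)" "1/2" 1] by (simp add: powr_half_sqrt del: of_nat_Suc)
      moreover have "real (Suc k) powr (- 3/2) = inverse (real (Suc k) powr (3/2))"
        using powr_minus[of "real (Suc k)" "3/2"] by simp
      ultimately have eq: "real (Suc k) powr (- 3/2) = inverse (sqrt (real (Suc k)) * real (Suc k))"
        by (simp only:)
      show ?thesis
        unfolding eq by (simp only: divide_inverse inverse_mult_distrib mult.assoc)
    qed
    finally show "norm (b k / real (Suc k)) \<le> C * real (Suc k) powr (- 3/2)" .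
  qed
qed

text \<open>The partial sums of \<open>y (k + 2) + y k\<close> are twice those of \<open>y\<close>
  up to four boundary terms, two of which are constant and two of which tend to 0. This replaces the
  Leibniz criterion, which would require monotonicity.\<close>

lemma summable_of_summable_add_shift2:
  fixes y :: "nat \<Rightarrow> real"
  assumes "summable (\<lambda>k. y (Suc (Suc k)) + y k)" "y \<longlonglongrightarrow> 0"
  shows "summable y"
proof -
  have eq: "(\<Sum>k<n. y k) = ((\<Sum>k<n. y (Suc (Suc k)) + y k) + y 0 + y 1 - y n - y (Suc n)) / 2" for n
    by (induction n) (simp_all add: field_simps)
  have "(\<lambda>n. ((\<Sum>k<n. y (Suc (Suc k)) + y k) + y 0 + y 1 - y n - y (Suc n)) / 2)
      \<longlonglongrightarrow> ((\<Sum>k. y (Suc (Suc k)) + y k) + y 0 + y 1 - 0 - 0) / 2"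
    by (intro tendsto_intros summable_LIMSEQ assms LIMSEQ_Suc[OF assms(2)]) simp_all
  then show ?thesis
    unfolding eq[symmetric] by (auto simp: summable_def sums_def)
qed

text \<open>Since \<open>csum (-1) a (k + 2) + csum (-1) a k = a (k + 2)\<close>, adding the shift
  by 2 leaves \<open>a (k + 2) / (k + 3)\<close> and an error from the change of denominator. Both
  are absolutely summable, although the terms themselves are only known to be of order
  \<open>1 / sqrt k\<close>.\<close>

lemma summable_csum_alternating_div:
  assumes "root_decay a"
  shows "summable (\<lambda>k. csum (-1) a k / real (Suc k))"
proof (rule summable_of_summable_add_shift2)
  obtain C where C: "0 \<le> C" "\<And>k. \<bar>a k\<bar> \<le> C / sqrt (real (Suc k))"
    using assms unfolding root_decay_def by auto
  have c: "\<bar>csum (-1) a k / real (Suc k)\<bar> \<le> C / sqrt (real (Suc k))" for k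
  proof -
    define u where "u = sqrt (real (Suc k))"
    have u: "0 < u" "real (Suc k) = u * u" by (simp_all add: u_def)
    have "\<bar>csum (-1) a k\<bar> \<le> C * u"
      unfolding u_def using C by (intro csum_abs_le) auto
    then have "\<bar>csum (-1) a k\<bar> / (u * u) \<le> C * u / (u * u)"
      by (intro divide_right_mono) auto
    then show ?thesis using u(1) unfolding u_def[symmetric] u(2) abs_divide by simp
  qed
  have "(\<lambda>k. C / sqrt (real (Suc k))) \<longlonglongrightarrow> 0"
    by real_asymp
  then show "(\<lambda>k. csum (-1) a k / real (Suc k)) \<longlonglongrightarrow> 0"
    by (rule Lim_null_comparison[rotated]) (use c in auto)
  have s2: "summable (\<lambda>k. \<bar>csum (-1) a k / real (Suc k) * (2 / real (Suc (Suc (Suc k))))\<bar>)"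
  proof -
    have "summable (\<lambda>k. \<bar>csum (-1) a k / real (Suc k)\<bar> / real (Suc k))"
      using C c by (intro summable_root_decay_div) (auto simp: root_decay_def)
    then have "summable (\<lambda>k. 2 * (\<bar>csum (-1) a k / real (Suc k)\<bar> / real (Suc k)))"
      by (rule summable_mult)
    then show ?thesis
    proof (rule summable_comparison_test'[where N=0])
      fix k
      have "2 / real (Suc (Suc (Suc k))) \<le> 2 / real (Suc k)"
        by (intro divide_left_mono) auto
      then show "norm \<bar>csum (-1) a k / real (Suc k) * (2 / real (Suc (Suc (Suc k))))\<bar>
          \<le> 2 * (\<bar>csum (-1) a k / real (Suc k)\<bar> / real (Suc k))"
        using mult_left_mono[of "2 / real (Suc (Suc (Suc k)))" "2 / real (Suc k)" "\<bar>csum (-1) a k / real (Suc k)\<bar>"]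
        by (simp add: abs_mult mult_ac)
    qed
  qed
  have "summable (\<lambda>k. a (Suc (Suc k)) / real (Suc (Suc (Suc k))))"
    using summable_root_decay_div[OF assms] summable_iff_shift[of "\<lambda>k. a k / real (Suc k)" 2] by simp
  from summable_add[OF this summable_rabs_cancel[OF s2]]
  have "summable (\<lambda>k. a (Suc (Suc k)) / real (Suc (Suc (Suc k)))
      + csum (-1) a k / real (Suc k) * (2 / real (Suc (Suc (Suc k)))))" .
  moreover have "a (Suc (Suc k)) / real (Suc (Suc (Suc k)))
      + csum (-1) a k / real (Suc k) * (2 / real (Suc (Suc (Suc k))))
      = csum (-1) a (Suc (Suc k)) / real (Suc (Suc (Suc k))) + csum (-1) a k / real (Suc k)" for k
  proof -
    have "x / u * (2 / (u + 2)) = - x / (u + 2) + x / u" if "u > 0" for x u :: real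
      using that by (simp add: field_simps)
    from this[of "real (Suc k)" "csum (-1) a k"] show ?thesis
      by (simp add: add_divide_distrib diff_divide_distrib)
  qed
  ultimately show "summable (\<lambda>k. csum (-1) a (Suc (Suc k)) / real (Suc (Suc (Suc k))) + csum (-1) a k / real (Suc k))"
    by simp
qed

text \<open>Only a head exponent 1 needs cancellation of signs. A larger one leaves a sequence of
  root decay divided by the index, which is summable by size alone.\<close>

lemma summable_nest_alternating:
  assumes "\<forall>c\<in>set cs. 0 < c"
  shows "summable (nest (-1) cs)"
proof (cases cs)
  case Nil
  then show ?thesis using sums_single[of 0 "\<lambda>_. 1::real"] by (auto simp: summable_def cong: if_cong)
next
  case (Cons c ds)
  then obtain d where c: "c = Suc d" using assms by (cases c) auto
  have "summable (\<lambda>k. nest (-1) cs (Suc k))"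
  proof (cases d)
    case 0
    have "summable (\<lambda>k. 2 * (csum (-1) (nest (-1) ds) k / real (Suc k)))"
      using assms Cons by (intro summable_mult summable_csum_alternating_div root_decay_nest) auto
    then show ?thesis using 0 c Cons by simp
  next
    case (Suc f)
    have "root_decay (nest (-1) (d # ds))"
      using assms Cons Suc by (intro root_decay_nest) auto
    then obtain C where C: "0 \<le> C" "\<And>k. \<bar>nest (-1) (d # ds) k\<bar> \<le> C / sqrt (real (Suc k))"
      unfolding root_decay_def by auto
    have "root_decay (\<lambda>k. nest (-1) (d # ds) (Suc k))"
      unfolding root_decay_def
    proof (intro exI[of _ C] conjI C allI)
      fix k
      have "C / sqrt (real (Suc (Suc k))) \<le> C / sqrt (real (Suc k))"
        using C by (intro divide_left_mono) auto
      then show "\<bar>nest (-1) (d # ds) (Suc k)\<bar> \<le> C / sqrt (real (Suc k))"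
        using C(2)[of "Suc k"] by linarith
    qed
    from summable_root_decay_div[OF this] show ?thesis
      by (simp add: Cons c divide_divide_eq_left mult.commute del: of_nat_Suc)
  qed
  then show ?thesis by (simp only: summable_Suc_iff)
qed

lemma summable_nest_comp: "summable (nest_comp (-1) r n)"
  unfolding nest_comp_def by (intro summable_sum summable_nest_alternating) (auto simp: Icomp_iff)

text \<open>With the weight written as depth plus excess \<open>q\<close>, one term lowers the
  excess and the other the depth. This is the shape to which \<open>DERIV_telescoping_sum\<close>
  applies, first with \<open>u = 1 / s\<close> and then with
  \<open>u = 2 / (1 + s^2)\<close>.\<close>

lemma DERIV_ps_nest_comp:
  assumes s: "0 < s" "s < 1"
  shows "(ps (nest_comp (-1) (Suc r) (q + Suc r)) has_real_derivative
          (if q = 0 then 0 else 1 / s * ps (nest_comp (-1) (Suc r) (q - 1 + Suc r)) s)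
            + 2 / (1 + s\<^sup>2) * ps (nest_comp (-1) r (q + r)) s) (at s)"
proof -
  have rd: "root_decay (nest_comp (-1) i j)" for i j
    by (rule root_decay_nest_comp) simp
  have s1: "\<bar>s\<bar> < 1" using s by simp
  let ?b = "nest_comp (-1) (Suc r) (q + r)"
  have sb: "(\<lambda>k. ?b k * s ^ k) sums ps ?b s"
    unfolding ps_def using summable_ps[OF rd s1] by (rule summable_sums)
  then have "(\<lambda>k. ?b (Suc k) * s ^ Suc k) sums ps ?b s"
    by (subst sums_Suc_iff) (simp add: nest_comp_Suc_0)
  from sums_mult[OF this, of "1 / s"]
  have sb': "(\<lambda>k. ?b (Suc k) * s ^ k) sums (1 / s * ps ?b s)"
    using s by simp
  have sc: "(\<lambda>k. 2 * (csum (-1) (nest_comp (-1) r (q + r)) k * s ^ k)) sums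
      (2 * ps (csum (-1) (nest_comp (-1) r (q + r))) s)"
    unfolding ps_def using summable_csum[OF rd _ s1, of "-1"] by (intro sums_mult summable_sums) auto
  have "(1 + s\<^sup>2) * ps (csum (-1) (nest_comp (-1) r (q + r))) s = ps (nest_comp (-1) r (q + r)) s"
    using ps_csum[OF rd _ s1, of "-1" r "q + r"] by simp
  moreover have "1 + s\<^sup>2 \<noteq> 0" by (smt (verit) zero_le_power2)
  ultimately have pc: "2 * ps (csum (-1) (nest_comp (-1) r (q + r))) s = 2 / (1 + s\<^sup>2) * ps (nest_comp (-1) r (q + r)) s"
    by (simp add: field_simps)
  have "(\<lambda>k. diffs (nest_comp (-1) (Suc r) (q + Suc r)) k * s ^ k) sums
      (1 / s * ps ?b s + 2 * ps (csum (-1) (nest_comp (-1) r (q + r))) s)"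
    using sums_add[OF sb' sc] unfolding diffs_def add_Suc_right nest_comp_Suc
    by (simp add: algebra_simps)
  then have "ps (diffs (nest_comp (-1) (Suc r) (q + Suc r))) s =
      1 / s * ps ?b s + 2 / (1 + s\<^sup>2) * ps (nest_comp (-1) r (q + r)) s"
    unfolding ps_def[of "diffs _"] pc by (simp only: sums_iff)
  \<comment> \<open>There are no compositions of \<open>r\<close> into \<open>Suc r\<close> positive
    parts.\<close>
  moreover have "ps ?b s = 0" if "q = 0"
    using that Icomp_eq_empty[of r "Suc r"] by (simp add: ps_def nest_comp_def)
  moreover have "q - 1 + Suc r = q + r" if "q \<noteq> 0" using that by simp
  ultimately have "ps (diffs (nest_comp (-1) (Suc r) (q + Suc r))) s =
    (if q = 0 then 0 else 1 / s * ps (nest_comp (-1) (Suc r) (q - 1 + Suc r)) s)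
            + 2 / (1 + s\<^sup>2) * ps (nest_comp (-1) r (q + r)) s"
    by (cases "q = 0") simp_all
  then show ?thesis using DERIV_ps[OF rd s1, of "Suc r" "q + Suc r"] by simp
qed

text \<open>Without constant term the series is of order \<open>s\<close>, which beats every power
  of the logarithm.\<close>

lemma tendsto_ps_mult_ln_power_at_right_0:
  assumes "root_decay b" "b 0 = 0"
  shows "((\<lambda>s. ps b s * (- ln s) ^ n) \<longlongrightarrow> 0) (at_right 0)"
proof -
  have "ps b 0 = 0"
    unfolding ps_def by (simp only: powser_zero assms)
  then have "((\<lambda>s. ps b s / s) \<longlongrightarrow> ps (diffs b) 0) (at 0)"
    using DERIV_ps[OF assms(1), of 0] by (simp add: DERIV_def)
  then have "((\<lambda>s. ps b s / s) \<longlongrightarrow> ps (diffs b) 0) (at_right 0)"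
    using at_le[of "{0<..}" UNIV 0] filterlim_mono by blast
  from tendsto_mult[OF this tendsto_mult_ln_power_at_right_0[of n]]
  have "((\<lambda>s. ps b s / s * (s * (- ln s) ^ n)) \<longlongrightarrow> 0) (at_right 0)" by simp
  moreover have "\<forall>\<^sub>F s in at_right 0. ps b s / s * (s * (- ln s) ^ n) = ps b s * (- ln s) ^ n"
    using eventually_at_right_less[of "0::real"] by (rule eventually_mono) auto
  ultimately show ?thesis by (rule Lim_transform_eventually)
qed

text \<open>For the boundary values at \<open>s = 1\<close>, where \<open>- ln s\<close> and
  \<open>pi / 2 - 2 * arctan s\<close> vanish: \<open>0 ^ 0 = 1\<close> keeps the top term
  alone.\<close>

lemma sum_mult_zero_power:
  fixes f :: "nat \<Rightarrow> real"
  shows "(\<Sum>i\<le>q. f i * 0 ^ (q - i) / fact (q - i)) = f q"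
proof -
  have "(\<Sum>i\<le>q. f i * 0 ^ (q - i) / fact (q - i)) = (\<Sum>i\<le>q. if i = q then f i else 0)"
    by (rule sum.cong) (auto simp: power_0_left)
  then show ?thesis by simp
qed

text \<open>Integrating the differential equations of the generating functions of \<open>nest_comp\<close> once for
  each logarithm and once for each arctangent gives an explicit antiderivative, whose value at
  \<open>s = 1\<close> is read off with Abel's theorem.\<close>

lemma has_integral_ln_arctan_powers:
  "((\<lambda>s. (- ln s) ^ q / fact q * ((pi / 2 - 2 * arctan s) ^ r / fact r) * (2 / (1 + s\<^sup>2)))
     has_integral (\<Sum>k. nest_comp (-1) (Suc r) (q + Suc r) k)) {0<..<1}"
proof -
  define A where "A = (\<lambda>j s. \<Sum>i\<le>q. ps (nest_comp (-1) j (i + j)) s * ((- ln s) ^ (q - i) / fact (q - i)))"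
  define B where "B = (\<lambda>s. \<Sum>i\<le>r. A (Suc i) s * ((pi / 2 - 2 * arctan s) ^ (r - i) / fact (r - i)))"
  have rd: "root_decay (nest_comp (-1) i j)" for i j
    by (rule root_decay_nest_comp) simp
  have A0: "A 0 s = (- ln s) ^ q / fact q" for s
  proof -
    have "ps (nest_comp (-1) 0 i) s = (if i = 0 then 1 else 0)" for i
    proof -
      have "(\<lambda>k. nest (-1) [] k * s ^ k) sums 1"
        using sums_single[of 0 "\<lambda>_. 1::real"] by (rule sums_cong[THEN iffD1, rotated]) auto
      then show ?thesis by (simp add: ps_def nest_comp_def Icomp_0_right sums_iff)
    qed
    then have "A 0 s = (\<Sum>i\<le>q. if i = 0 then (- ln s) ^ q / fact q else 0)"
      unfolding A_def by (intro sum.cong) auto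
    then show ?thesis by simp
  qed
  have dA: "(A (Suc j) has_real_derivative 2 / (1 + s\<^sup>2) * A j s) (at s)" if s: "0 < s" "s < 1" for j s
  proof -
    have "(A (Suc j) has_real_derivative
        (\<Sum>i\<le>q. 2 / (1 + s\<^sup>2) * ps (nest_comp (-1) j (i + j)) s * ((- ln s) ^ (q - i) / fact (q - i)))) (at s)"
      unfolding A_def
    proof (rule DERIV_telescoping_sum)
      show "((\<lambda>s. - ln s) has_real_derivative - (1 / s)) (at s)"
        using s by (auto intro!: derivative_eq_intros)
    qed (rule DERIV_ps_nest_comp[OF s])
    then show ?thesis by (simp add: A_def sum_distrib_left mult.assoc)
  qed
  have dB: "(B has_real_derivative
      (- ln s) ^ q / fact q * ((pi / 2 - 2 * arctan s) ^ r / fact r) * (2 / (1 + s\<^sup>2))) (at s)"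
    if s: "s \<in> {0<..<1}" for s
  proof -
    \<comment> \<open>Second use of the telescoping lemma, now with \<open>F i = A (Suc i)\<close>.
      The shift by one makes \<open>A 0\<close>, a pure power of the logarithm, the only
      inhomogeneous term.\<close>
    have "(B has_real_derivative
        (\<Sum>i\<le>r. (if i = 0 then 2 / (1 + s\<^sup>2) * A 0 s else 0) * ((pi / 2 - 2 * arctan s) ^ (r - i) / fact (r - i)))) (at s)"
      unfolding B_def
    proof (rule DERIV_telescoping_sum)
      have "((\<lambda>s. pi / 2 - 2 * arctan s) has_real_derivative 0 - 2 * inverse (1 + s\<^sup>2)) (at s)"
        by (intro DERIV_diff DERIV_const DERIV_cmult DERIV_arctan)
      then show "((\<lambda>s. pi / 2 - 2 * arctan s) has_real_derivative - (2 / (1 + s\<^sup>2))) (at s)"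
        by (simp only: divide_inverse diff_0)
      fix i
      show "(A (Suc i) has_real_derivative
          (if i = 0 then 0 else 2 / (1 + s\<^sup>2) * A (Suc (i - 1)) s) + (if i = 0 then 2 / (1 + s\<^sup>2) * A 0 s else 0)) (at s)"
        using dA[of s i] s by (cases i) auto
    qed
    also have "(\<Sum>i\<le>r. (if i = 0 then 2 / (1 + s\<^sup>2) * A 0 s else 0) * ((pi / 2 - 2 * arctan s) ^ (r - i) / fact (r - i)))
      = (\<Sum>i\<le>r. if i = 0 then 2 / (1 + s\<^sup>2) * A 0 s * ((pi / 2 - 2 * arctan s) ^ r / fact r) else 0)"
      by (rule sum.cong) auto
    finally show ?thesis by (simp add: A0 mult_ac)
  qed
  have A1: "(A j \<longlongrightarrow> suminf (nest_comp (-1) j (q + j))) (at_left 1)" for j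
  proof -
    have "(A j \<longlongrightarrow> (\<Sum>i\<le>q. suminf (nest_comp (-1) j (i + j)) * ((- ln 1) ^ (q - i) / fact (q - i)))) (at_left 1)"
      unfolding A_def ps_def by (intro tendsto_intros Abel_limit summable_nest_comp) auto
    then show ?thesis by (simp add: sum_mult_zero_power)
  qed
  have "(B \<longlongrightarrow> (\<Sum>i\<le>r. suminf (nest_comp (-1) (Suc i) (q + Suc i)) * ((pi / 2 - 2 * arctan 1) ^ (r - i) / fact (r - i)))) (at_left 1)"
    unfolding B_def by (intro tendsto_intros A1) auto
  then have B1: "(B \<longlongrightarrow> suminf (nest_comp (-1) (Suc r) (q + Suc r))) (at_left 1)"
    by (simp add: arctan_one sum_mult_zero_power)
  have A0': "(A (Suc j) \<longlongrightarrow> 0) (at_right 0)" for j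
  proof -
    have "(A (Suc j) \<longlongrightarrow> (\<Sum>i\<le>q. 0 / fact (q - i))) (at_right 0)"
      unfolding A_def times_divide_eq_right
      by (intro tendsto_intros tendsto_ps_mult_ln_power_at_right_0 rd nest_comp_Suc_0) auto
    then show ?thesis by simp
  qed
  have "(B \<longlongrightarrow> (\<Sum>i\<le>r. 0 * ((pi / 2 - 2 * arctan 0) ^ (r - i) / fact (r - i)))) (at_right 0)"
    unfolding B_def by (intro tendsto_intros A0') auto
  then have B0: "(B \<longlongrightarrow> 0) (at_right 0)" by simp
  show ?thesis
    using has_integral_Ioo_of_limits[OF _ dB B0 B1] by simp
qed

section \<open>Moments of powers of the logarithm\<close>

text \<open>The coefficients of \<open>- Li_i (- s)\<close>, the alternating polylogarithm.\<close>

definition eta_coeff :: "nat \<Rightarrow> nat \<Rightarrow> real" where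
  "eta_coeff i k = (if k = 0 then 0 else (-1) ^ (k - 1) / real k ^ i)"

lemma root_decay_eta_coeff: "root_decay (eta_coeff (Suc i))"
  unfolding root_decay_def
proof (intro exI[of _ 2] conjI allI)
  fix k
  show "\<bar>eta_coeff (Suc i) k\<bar> \<le> 2 / sqrt (real (Suc k))"
  proof (cases k)
    case (Suc j)
    have "real k ^ 1 \<le> real k ^ Suc i" using Suc by (intro power_increasing) auto
    then have "\<bar>eta_coeff (Suc i) k\<bar> \<le> 1 / real k"
      using Suc unfolding eta_coeff_def by (simp add: abs_divide power_abs divide_left_mono)
    also have "\<dots> \<le> 2 / sqrt (real (Suc k))"
    proof -
      have "real (Suc k) \<le> 2 * real k * (2 * real k)"
        using mult_mono[of 1 "real k" 1 "real k"] Suc by (simp add: algebra_simps)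
      then have "sqrt (real (Suc k)) \<le> 2 * real k"
        by (intro real_le_lsqrt) (auto simp: power2_eq_square)
      then show ?thesis using Suc by (simp add: field_simps)
    qed
    finally show ?thesis .
  qed (simp add: eta_coeff_def)
qed simp

lemma summable_eta_coeff: "summable (eta_coeff (Suc i))"
proof -
  have "summable (\<lambda>n. (-1) ^ n * (1 / real (Suc n) ^ Suc i))"
  proof (rule summable_Leibniz(1))
    show "(\<lambda>n. 1 / real (Suc n) ^ Suc i) \<longlonglongrightarrow> 0" by real_asymp
    have "decseq (\<lambda>n. 1 / real (Suc n) ^ Suc i)"
      unfolding decseq_def by (auto intro!: divide_left_mono power_mono mult_pos_pos simp del: power_Suc)
    then show "monoseq (\<lambda>n. 1 / real (Suc n) ^ Suc i)" by (rule decseq_imp_monoseq)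
  qed
  then have "summable (\<lambda>n. eta_coeff (Suc i) (Suc n))"
    by (simp add: eta_coeff_def del: power_Suc of_nat_Suc)
  then show ?thesis by (simp only: summable_Suc_iff)
qed

lemma suminf_eta_coeff: "suminf (eta_coeff (Suc i)) = zetabar (Suc i)"
  using suminf_split_head[OF summable_eta_coeff, of i]
  by (simp add: zetabar_def eta_coeff_def del: power_Suc of_nat_Suc)

lemma DERIV_ps_eta_coeff:
  assumes s: "0 < s" "s < 1"
  shows "(ps (eta_coeff (Suc i)) has_real_derivative
          1 / s * (if i = 0 then s / (1 + s) else ps (eta_coeff i) s)) (at s)"
proof -
  have s1: "\<bar>s\<bar> < 1" using s by simp
  have "(\<lambda>k. diffs (eta_coeff (Suc i)) k * s ^ k) sums (1 / s * (if i = 0 then s / (1 + s) else ps (eta_coeff i) s))"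
  proof (cases i)
    case 0
    have "(\<lambda>k. (- s) ^ k) sums (1 / (1 - (- s)))"
      using s by (intro geometric_sums) auto
    moreover have "diffs (eta_coeff (Suc i)) k * s ^ k = (- s) ^ k" for k
      by (simp add: 0 diffs_def eta_coeff_def power_minus[of s] del: of_nat_Suc)
    ultimately show ?thesis using 0 s by simp
  next
    case (Suc j)
    have "(\<lambda>k. eta_coeff i k * s ^ k) sums ps (eta_coeff i) s"
      unfolding ps_def Suc by (intro summable_sums summable_ps root_decay_eta_coeff s1)
    then have "(\<lambda>k. eta_coeff i (Suc k) * s ^ Suc k) sums ps (eta_coeff i) s"
      by (subst sums_Suc_iff) (simp add: eta_coeff_def)
    from sums_mult[OF this, of "1 / s"]
    have "(\<lambda>k. eta_coeff i (Suc k) * s ^ k) sums (1 / s * ps (eta_coeff i) s)"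
      using s by simp
    moreover have "diffs (eta_coeff (Suc i)) k = eta_coeff i (Suc k)" for k
      by (simp add: diffs_def eta_coeff_def del: of_nat_Suc)
    ultimately show ?thesis using Suc by simp
  qed
  then have "ps (diffs (eta_coeff (Suc i))) s = 1 / s * (if i = 0 then s / (1 + s) else ps (eta_coeff i) s)"
    unfolding ps_def[of "diffs _"] by (simp only: sums_iff)
  then show ?thesis using DERIV_ps[OF root_decay_eta_coeff s1, of i] by simp
qed

text \<open>The weight is the derivative of \<open>s / (1 + s)\<close>. Repeated integration against
  \<open>1 / s\<close> raises the order of the polylogarithm, and its value at 1 is
  \<open>zetabar\<close>.\<close>

lemma has_integral_ln_power_zetabar:
  "((\<lambda>s. (- ln s) ^ q / fact q * (1 / (1 + s)\<^sup>2)) has_integral zetabar q) {0<..<1}"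
proof -
  \<comment> \<open>For \<open>i = 0\<close> the closed form replaces a series that diverges at
    \<open>s = 1\<close>; its limit 1/2 is the convention for \<open>zetabar 0\<close>.\<close>
  define f where "f = (\<lambda>i s. if i = 0 then s / (1 + s) else ps (eta_coeff i) s)"
  define B where "B = (\<lambda>s. \<Sum>i\<le>q. f i s * ((- ln s) ^ (q - i) / fact (q - i)))"
  have dB: "(B has_real_derivative (- ln s) ^ q / fact q * (1 / (1 + s)\<^sup>2)) (at s)"
    if "s \<in> {0<..<1}" for s
  proof -
    have s: "0 < s" "s < 1" using that by auto
    have "(B has_real_derivative
        (\<Sum>i\<le>q. (if i = 0 then 1 / (1 + s)\<^sup>2 else 0) * ((- ln s) ^ (q - i) / fact (q - i)))) (at s)"
      unfolding B_def
    proof (rule DERIV_telescoping_sum)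
      show "((\<lambda>s. - ln s) has_real_derivative - (1 / s)) (at s)"
        using s by (auto intro!: derivative_eq_intros)
      fix i
      show "(f i has_real_derivative (if i = 0 then 0 else 1 / s * f (i - 1) s)
          + (if i = 0 then 1 / (1 + s)\<^sup>2 else 0)) (at s)"
      proof (cases i)
        case 0
        have "((\<lambda>s. s / (1 + s)) has_real_derivative 1 / (1 + s)\<^sup>2) (at s)"
          using s by (auto intro!: derivative_eq_intros simp: power2_eq_square)
        then show ?thesis using 0 by (simp add: f_def)
      next
        case (Suc j)
        then show ?thesis using DERIV_ps_eta_coeff[OF s, of j] by (auto simp: f_def)
      qed
    qed
    also have "(\<Sum>i\<le>q. (if i = 0 then 1 / (1 + s)\<^sup>2 else 0) * ((- ln s) ^ (q - i) / fact (q - i)))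
      = (\<Sum>i\<le>q. if i = 0 then (- ln s) ^ q / fact q * (1 / (1 + s)\<^sup>2) else 0)"
      by (rule sum.cong) auto
    finally show ?thesis by simp
  qed
  have f1: "(f i \<longlongrightarrow> zetabar i) (at_left 1)" for i
  proof (cases i)
    case 0
    have "((\<lambda>s. s / (1 + s)) \<longlongrightarrow> 1 / (1 + 1)) (at_left (1::real))"
      by (intro tendsto_intros) auto
    then show ?thesis by (simp add: f_def 0 zetabar_def)
  next
    case (Suc j)
    then show ?thesis
      using Abel_limit[OF summable_eta_coeff, of j] by (simp add: f_def ps_def suminf_eta_coeff)
  qed
  have "(B \<longlongrightarrow> (\<Sum>i\<le>q. zetabar i * ((- ln 1) ^ (q - i) / fact (q - i)))) (at_left 1)"
    unfolding B_def by (intro tendsto_intros f1) auto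
  then have B1: "(B \<longlongrightarrow> zetabar q) (at_left 1)"
    by (simp add: sum_mult_zero_power)
  have f0: "((\<lambda>s. f i s * (- ln s) ^ n) \<longlongrightarrow> 0) (at_right 0)" for i n
  proof (cases i)
    case 0
    have "((\<lambda>s. s * (- ln s) ^ n / (1 + s)) \<longlongrightarrow> 0 / (1 + 0)) (at_right (0::real))"
      by (intro tendsto_intros tendsto_mult_ln_power_at_right_0) auto
    then show ?thesis by (simp add: f_def 0)
  next
    case (Suc j)
    then show ?thesis
      using tendsto_ps_mult_ln_power_at_right_0[OF root_decay_eta_coeff, of j n]
      by (simp add: f_def eta_coeff_def)
  qed
  have "(B \<longlongrightarrow> (\<Sum>i\<le>q. 0 / fact (q - i))) (at_right 0)"
    unfolding B_def times_divide_eq_right by (intro tendsto_intros f0) auto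
  then have B0: "(B \<longlongrightarrow> 0) (at_right 0)" by simp
  show ?thesis
    using has_integral_Ioo_of_limits[OF _ dB B0 B1] by simp
qed

text \<open>The coefficients of \<open>h x ^ r / fact r / (1 - e * x^2)\<close> with
  \<open>h\<close> as in \<open>ps_nest_replicate\<close>. For \<open>e = 1\<close> they are the
  finite sums \<open>T\<close>, and the extra denominator is the summation over the last
  index.\<close>

definition tsum :: "real \<Rightarrow> nat \<Rightarrow> nat \<Rightarrow> real" where
  "tsum e r = csum e (nest e (replicate r 1))"

lemma tsum_0_0 [simp]: "tsum e 0 0 = 1"
  and tsum_Suc_0 [simp]: "tsum e (Suc r) 0 = 0"
  and tsum_0_1 [simp]: "tsum e 0 (Suc 0) = 0"
  and tsum_Suc_1: "tsum e (Suc r) (Suc 0) = 2 * tsum e r 0"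
  and tsum_0_Suc_Suc: "tsum e 0 (Suc (Suc k)) = e * tsum e 0 k"
  and tsum_Suc_Suc_Suc: "tsum e (Suc r) (Suc (Suc k)) =
        e * tsum e (Suc r) k + 2 / real (Suc (Suc k)) * tsum e r (Suc k)"
  by (simp_all add: tsum_def)

lemma csum_parity: "(\<And>k. odd (k + r) \<Longrightarrow> a k = 0) \<Longrightarrow> odd (k + r) \<Longrightarrow> csum e a k = 0"
  by (induction k rule: induct_nat_012) auto

lemma nest_parity: "odd (k + length cs) \<Longrightarrow> nest e cs k = 0"
proof (induction cs arbitrary: k)
  case (Cons c cs)
  show ?case
  proof (cases k)
    case (Suc j)
    then have "odd (j + length cs)" using Cons.prems by simp
    then have "csum e (nest e cs) j = 0" using Cons.IH by (intro csum_parity) auto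
    then show ?thesis using Suc by simp
  qed simp
qed (auto elim: oddE)

lemma tsum_parity: "odd (k + r) \<Longrightarrow> tsum e r k = 0"
  unfolding tsum_def by (intro csum_parity[of r]) (auto intro: nest_parity)

text \<open>Integrals over \<open>x\<close> are kept as integrals over \<open>s\<close> with weight
  \<open>2 / (1 + s)^2 = - dx / ds\<close>, so no change of variables is carried out.\<close>

definition cayley :: "real \<Rightarrow> real" where
  "cayley s = (1 - s) / (1 + s)"

lemma DERIV_cayley: "0 < s \<Longrightarrow> (cayley has_real_derivative - (2 / (1 + s)\<^sup>2)) (at s)"
  unfolding cayley_def by (auto intro!: derivative_eq_intros simp: power2_eq_square field_simps)

lemma one_minus_cayley_square: "0 < s \<Longrightarrow> 1 - (cayley s)\<^sup>2 = 2 * s * (2 / (1 + s)\<^sup>2)"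
proof -
  assume "0 < s"
  then have "1 - (cayley s)\<^sup>2 = ((1 + s)\<^sup>2 - (1 - s)\<^sup>2) / (1 + s)\<^sup>2"
    unfolding cayley_def power_divide by (simp add: diff_divide_distrib[of "(1 + s)\<^sup>2"])
  also have "(1 + s)\<^sup>2 - (1 - s)\<^sup>2 = 4 * s"
    by (simp add: power2_eq_square algebra_simps)
  finally show ?thesis by simp
qed

text \<open>The integrand is the derivative of \<open>(1 - x\<^sup>2) x ^ k (- ln s) ^ q / q!\<close> for \<open>x = cayley s\<close>, which
  vanishes at both ends.\<close>

lemma has_integral_cayley_boundary:
  assumes "0 < k \<or> 0 < q"
  shows "((\<lambda>s. 2 / (1 + s)\<^sup>2 * ((real (k + 2) * cayley s ^ (k + 1) - real k * cayley s ^ (k - 1)) * ((- ln s) ^ q / fact q)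
      - 2 * cayley s ^ k * (if q = 0 then 0 else (- ln s) ^ (q - 1) / fact (q - 1)))) has_integral 0) {0<..<1}"
proof -
  define H where "H = (\<lambda>s. (1 - (cayley s)\<^sup>2) * cayley s ^ k * ((- ln s) ^ q / fact q))"
  have dH: "(H has_real_derivative 2 / (1 + s)\<^sup>2 * ((real (k + 2) * cayley s ^ (k + 1) - real k * cayley s ^ (k - 1)) * ((- ln s) ^ q / fact q)
      - 2 * cayley s ^ k * (if q = 0 then 0 else (- ln s) ^ (q - 1) / fact (q - 1)))) (at s)"
    if "s \<in> {0<..<1}" for s
  proof -
    have s: "0 < s" "s < 1" using that by auto
    define w where "w = 2 / (1 + s)\<^sup>2"
    define c where "c = cayley s"
    define L where "L = (- ln s) ^ q / fact q"
    define L' where "L' = (if q = 0 then 0 else (- ln s) ^ (q - 1) / fact (q - 1))"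
    have dc: "(cayley has_real_derivative - w) (at s)"
      unfolding w_def by (rule DERIV_cayley[OF s(1)])
    have d1: "((\<lambda>s. cayley s ^ k - cayley s ^ (k + 2)) has_real_derivative
        real k * (- w * c ^ (k - 1)) - real (k + 2) * (- w * c ^ (k + 1))) (at s)"
      using DERIV_diff[OF DERIV_power[OF dc, of k] DERIV_power[OF dc, of "k + 2"]]
      by (simp add: c_def)
    have dl: "((\<lambda>s. - ln s) has_real_derivative - (1 / s)) (at s)"
      using s by (auto intro!: derivative_eq_intros)
    have d2: "((\<lambda>s. (- ln s) ^ q / fact q) has_real_derivative - (1 / s) * L') (at s)"
    proof (cases q)
      case (Suc p)
      then show ?thesis
        using DERIV_cdivide[OF DERIV_power[OF dl, of q], of "fact q"]
        by (simp add: L'_def mult.assoc del: of_nat_Suc power_Suc)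
    qed (simp add: L'_def)
    have "H = (\<lambda>s. (cayley s ^ k - cayley s ^ (k + 2)) * ((- ln s) ^ q / fact q))"
      unfolding H_def by (rule ext) (simp add: algebra_simps power2_eq_square)
    then have "(H has_real_derivative
        (c ^ k - c ^ (k + 2)) * (- (1 / s) * L') + (real k * (- w * c ^ (k - 1)) - real (k + 2) * (- w * c ^ (k + 1))) * L) (at s)"
      using DERIV_mult'[OF d1 d2] by (simp add: c_def L_def)
    \<comment> \<open>The factor \<open>s\<close> cancels the \<open>1 / s\<close> from the
      logarithm, so the derivative is again a combination of moment integrands.\<close>
    moreover have "c ^ k - c ^ (k + 2) = c ^ k * (2 * s * w)"
    proof -
      have "c ^ k - c ^ (k + 2) = c ^ k * (1 - c\<^sup>2)"
        by (simp add: algebra_simps power2_eq_square)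
      then show ?thesis using one_minus_cayley_square[OF s(1)] by (simp only: c_def w_def)
    qed
    moreover have "c ^ k * (2 * s * w) * (- (1 / s) * L')
        + (real k * (- w * c ^ (k - 1)) - real (k + 2) * (- w * c ^ (k + 1))) * L
      = w * ((real (k + 2) * c ^ (k + 1) - real k * c ^ (k - 1)) * L - 2 * c ^ k * L')"
      using s by (simp add: algebra_simps)
    ultimately have "(H has_real_derivative
        w * ((real (k + 2) * c ^ (k + 1) - real k * c ^ (k - 1)) * L - 2 * c ^ k * L')) (at s)"
      by (simp only:)
    then show ?thesis by (simp only: w_def c_def L_def L'_def)
  qed
  have c1: "(cayley \<longlongrightarrow> 0) (at_left 1)"
  proof -
    have "(cayley \<longlongrightarrow> (1 - 1) / (1 + 1)) (at_left 1)"
      unfolding cayley_def by (intro tendsto_intros) auto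
    then show ?thesis by simp
  qed
  have c0: "(cayley \<longlongrightarrow> 1) (at_right 0)"
  proof -
    have "(cayley \<longlongrightarrow> (1 - 0) / (1 + 0)) (at_right 0)"
      unfolding cayley_def by (intro tendsto_intros) auto
    then show ?thesis by simp
  qed
  have "(H \<longlongrightarrow> (1 - 0\<^sup>2) * 0 ^ k * ((- ln 1) ^ q / fact q)) (at_left 1)"
    unfolding H_def by (intro tendsto_intros c1) auto
  then have H1: "(H \<longlongrightarrow> 0) (at_left 1)"
    using assms by (auto simp: power_0_left split: if_splits)
  have "((\<lambda>s. 4 / (1 + s)\<^sup>2 * cayley s ^ k * (s * (- ln s) ^ q / fact q)) \<longlongrightarrow>
      4 / (1 + 0)\<^sup>2 * 1 ^ k * (0 / fact q)) (at_right 0)"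
    by (intro tendsto_intros c0 tendsto_mult_ln_power_at_right_0) auto
  then have "((\<lambda>s. 4 / (1 + s)\<^sup>2 * cayley s ^ k * (s * (- ln s) ^ q / fact q)) \<longlongrightarrow> 0) (at_right 0)"
    by simp
  moreover have "\<forall>\<^sub>F s in at_right 0. 4 / (1 + s)\<^sup>2 * cayley s ^ k * (s * (- ln s) ^ q / fact q) = H s"
    using eventually_at_right_less[of "0::real"]
    by (rule eventually_mono) (simp add: H_def one_minus_cayley_square mult_ac)
  ultimately have H0: "(H \<longlongrightarrow> 0) (at_right 0)"
    by (rule Lim_transform_eventually)
  show ?thesis
    using has_integral_Ioo_of_limits[OF _ dH H0 H1] by simp
qed

text \<open>All \<open>i\<close> are included, although for given \<open>k\<close> parity leaves
  every second one: the recursion in \<open>k\<close> lowers \<open>i\<close> by one and is thus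
  inherited termwise.\<close>

definition tsum_conv :: "nat \<Rightarrow> nat \<Rightarrow> real" where
  "tsum_conv q k = (\<Sum>i\<le>q. 2 * zetabar (q - i) * tsum 1 i k)"

lemma tsum_conv_0: "tsum_conv q 0 = 2 * zetabar q"
proof -
  have "tsum_conv q 0 = (\<Sum>i\<le>q. if i = 0 then 2 * zetabar q else 0)"
    unfolding tsum_conv_def
  proof (rule sum.cong)
    fix i show "2 * zetabar (q - i) * tsum 1 i 0 = (if i = 0 then 2 * zetabar q else 0)"
      by (cases i) auto
  qed simp
  then show ?thesis by simp
qed

lemma tsum_conv_Suc_1: "tsum_conv (Suc q) (Suc 0) = 2 * tsum_conv q 0"
  by (simp add: tsum_conv_def sum.atMost_Suc_shift tsum_Suc_1 sum_distrib_left mult_ac del: sum.atMost_Suc)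

lemma tsum_conv_0_Suc_Suc: "tsum_conv 0 (Suc (Suc k)) = tsum_conv 0 k"
  by (simp add: tsum_conv_def tsum_0_Suc_Suc)

lemma tsum_conv_Suc_Suc_Suc:
  "tsum_conv (Suc q) (Suc (Suc k)) = tsum_conv (Suc q) k + 2 / real (Suc (Suc k)) * tsum_conv q (Suc k)"
  by (simp add: tsum_conv_def sum.atMost_Suc_shift tsum_Suc_Suc_Suc tsum_0_Suc_Suc sum.distrib
        sum_distrib_left algebra_simps del: sum.atMost_Suc of_nat_Suc)

text \<open>The parity condition is needed: for \<open>k\<close> and \<open>q\<close> of different parity the boundary term of
  the case \<open>k = q = 0\<close> above enters.\<close>

lemma has_integral_cayley_power:
  assumes "even (k + q)"
  shows "((\<lambda>s. real (Suc k) * cayley s ^ k * ((- ln s) ^ q / fact q) * (2 / (1 + s)\<^sup>2))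
           has_integral tsum_conv q k) {0<..<1}"
  using assms
proof (induction k arbitrary: q rule: induct_nat_012)
  case 0
  show ?case
    using has_integral_mult_right[OF has_integral_ln_power_zetabar, of 2 q]
    by (simp add: tsum_conv_0 mult_ac)
next
  case 1
  then obtain p where q: "q = Suc p" by (cases q) auto
  \<comment> \<open>The factor 4 below compensates the term \<open>- 2 * (2 / (1 + s)^2)\<close> of
    the boundary identity at \<open>k = 0\<close>.\<close>
  have "((\<lambda>s. (- ln s) ^ p / fact p * (1 / (1 + s)\<^sup>2)) has_integral zetabar p) {0<..<1}"
    by (rule has_integral_ln_power_zetabar)
  from has_integral_add[OF has_integral_cayley_boundary[of 0 q] has_integral_mult_right[OF this, of 4]]
  show ?case
    by (simp add: q tsum_conv_Suc_1 tsum_conv_0 algebra_simps)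
next
  case (ge2 k)
  have A: "((\<lambda>s. real (Suc k) * cayley s ^ k * ((- ln s) ^ q / fact q) * (2 / (1 + s)\<^sup>2))
           has_integral tsum_conv q k) {0<..<1}"
    using ge2 by auto
  \<comment> \<open>This expresses the moment at \<open>Suc (Suc k)\<close> through the one at
    \<open>k\<close> and, with \<open>q\<close> lowered by one, the one at \<open>Suc k\<close>.
    Both keep the parity of \<open>k + q\<close>, and the coefficients are those of
    \<open>tsum_conv\<close>.\<close>
  note B = has_integral_cayley_boundary[of "Suc k" q]
  show ?case
  proof (cases q)
    case 0
    from has_integral_add[OF B A] show ?thesis
      by (simp add: 0 tsum_conv_0_Suc_Suc algebra_simps)
  next
    case (Suc p)
    have "((\<lambda>s. real (Suc (Suc k)) * cayley s ^ Suc k * ((- ln s) ^ p / fact p) * (2 / (1 + s)\<^sup>2))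
           has_integral tsum_conv p (Suc k)) {0<..<1}"
      using ge2 Suc by auto
    from has_integral_add[OF has_integral_add[OF B A] has_integral_mult_right[OF this, of "2 / real (Suc (Suc k))"]]
    have "((\<lambda>s. 2 / (1 + s)\<^sup>2 * ((real (Suc k + 2) * cayley s ^ (Suc k + 1) - real (Suc k) * cayley s ^ (Suc k - 1)) * ((- ln s) ^ q / fact q)
      - 2 * cayley s ^ Suc k * (if q = 0 then 0 else (- ln s) ^ (q - 1) / fact (q - 1)))
       + real (Suc k) * cayley s ^ k * ((- ln s) ^ q / fact q) * (2 / (1 + s)\<^sup>2)
       + 2 / real (Suc (Suc k)) * (real (Suc (Suc k)) * cayley s ^ Suc k * ((- ln s) ^ p / fact p) * (2 / (1 + s)\<^sup>2)))
      has_integral tsum_conv q (Suc (Suc k))) {0<..<1}"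
      by (simp only: Suc tsum_conv_Suc_Suc_Suc) simp
    then show ?thesis
    proof (rule has_integral_eq[rotated])
      fix s :: real
      have gen: "w * ((a * C2 - b * C0) * L - 2 * C1 * L') + b * C0 * L * w + 2 / d * (d * C1 * L' * w) = a * C2 * L * w"
        if "d \<noteq> 0" for w a b d C0 C1 C2 L L' :: real
        using that by (simp add: algebra_simps)
      show "2 / (1 + s)\<^sup>2 * ((real (Suc k + 2) * cayley s ^ (Suc k + 1) - real (Suc k) * cayley s ^ (Suc k - 1)) * ((- ln s) ^ q / fact q)
      - 2 * cayley s ^ Suc k * (if q = 0 then 0 else (- ln s) ^ (q - 1) / fact (q - 1)))
       + real (Suc k) * cayley s ^ k * ((- ln s) ^ q / fact q) * (2 / (1 + s)\<^sup>2)
       + 2 / real (Suc (Suc k)) * (real (Suc (Suc k)) * cayley s ^ Suc k * ((- ln s) ^ p / fact p) * (2 / (1 + s)\<^sup>2))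
       = real (Suc (Suc (Suc k))) * cayley s ^ Suc (Suc k) * ((- ln s) ^ q / fact q) * (2 / (1 + s)\<^sup>2)"
        using gen[of "real (Suc (Suc k))" "2 / (1 + s)\<^sup>2" "real (Suc k + 2)" "cayley s ^ (Suc k + 1)" "real (Suc k)"
            "cayley s ^ k" "(- ln s) ^ q / fact q" "cayley s ^ Suc k" "(- ln s) ^ p / fact p"] Suc
        by (simp del: of_nat_Suc power_Suc fact_Suc)
    qed
  qed
qed

section \<open>Termwise integration\<close>

lemma csum_nonneg: "(\<And>k. 0 \<le> a k) \<Longrightarrow> 0 \<le> csum 1 a k"
  by (induction k rule: induct_nat_012) auto

lemma nest_nonneg: "0 \<le> nest 1 cs k"
  by (induction cs arbitrary: k) (auto intro!: csum_nonneg divide_nonneg_nonneg)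

lemma csum_abs_le_csum:
  assumes "\<bar>e\<bar> \<le> 1" "\<And>k. \<bar>a k\<bar> \<le> b k"
  shows "\<bar>csum e a k\<bar> \<le> csum 1 b k"
proof (induction k rule: induct_nat_012)
  case (ge2 k)
  have "\<bar>e * csum e a k\<bar> \<le> 1 * csum 1 b k"
    unfolding abs_mult using ge2 assms by (intro mult_mono) auto
  then show ?case using assms(2)[of "Suc (Suc k)"] by simp
qed (use assms in auto)

lemma nest_abs_le_nest: "\<bar>e\<bar> \<le> 1 \<Longrightarrow> \<bar>nest e cs k\<bar> \<le> nest 1 cs k"
proof (induction cs arbitrary: k)
  case (Cons c cs)
  show ?case
  proof (cases k)
    case (Suc j)
    have "\<bar>csum e (nest e cs) j\<bar> \<le> csum 1 (nest 1 cs) j"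
      using Cons by (intro csum_abs_le_csum) auto
    then show ?thesis
      unfolding Suc nest_Cons_Suc abs_divide abs_mult by (auto intro!: divide_right_mono simp: power_abs)
  qed simp
qed simp

text \<open>\<open>csum 1 b k\<close> adds the \<open>b j\<close> with \<open>j \<le> k\<close> of
  the parity of \<open>k\<close>, and \<open>x ^ k \<le> x ^ j\<close> for these.\<close>

lemma csum_mult_power_le:
  assumes "\<And>k. 0 \<le> b k" "0 \<le> x" "x \<le> 1"
  shows "csum 1 b k * x ^ k \<le> (\<Sum>j\<le>k. b j * x ^ j)"
proof (induction k rule: induct_nat_012)
  case 1
  show ?case using assms by simp
next
  case (ge2 k)
  have "x ^ Suc (Suc k) \<le> x ^ k"
    using assms by (intro power_decreasing) auto
  then have "csum 1 b k * x ^ Suc (Suc k) \<le> csum 1 b k * x ^ k"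
    using csum_nonneg[of b k] assms by (intro mult_left_mono) auto
  also have "\<dots> \<le> (\<Sum>j\<le>Suc k. b j * x ^ j)"
    using ge2(1) assms by (simp add: add_increasing2)
  finally show ?case by (simp add: distrib_right)
qed simp

lemma cayley_bounds: "0 < s \<Longrightarrow> s < 1 \<Longrightarrow> 0 < cayley s \<and> cayley s < 1"
  by (simp add: cayley_def)

lemma ps_nest_ln:
  assumes s: "0 < s" "s < 1"
  shows "ps (nest 1 (replicate r 1)) (cayley s) = (- ln s) ^ r / fact r"
proof -
  have "ps (nest 1 (replicate r 1)) (cayley s) = (ln (1 + cayley s) - ln (1 - cayley s)) ^ r / fact r"
  proof (rule ps_nest_replicate)
    fix x :: real assume x: "\<bar>x\<bar> < 1"
    then have pos: "0 < 1 + x" "0 < 1 - x" by auto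
    have "((\<lambda>x. ln (1 + x) - ln (1 - x)) has_real_derivative 1 / (1 + x) + 1 / (1 - x)) (at x)"
      using pos by (auto intro!: derivative_eq_intros)
    moreover have "1 / (1 + x) + 1 / (1 - x) = 2 / (1 - 1 * x\<^sup>2)"
      using pos by (subst add_frac_eq) (auto simp: power2_eq_square algebra_simps)
    ultimately show "((\<lambda>x. ln (1 + x) - ln (1 - x)) has_real_derivative 2 / (1 - 1 * x\<^sup>2)) (at x)"
      by (simp only:)
  qed (use cayley_bounds[OF s] in auto)
  moreover have "1 - cayley s = s * (1 + cayley s)"
    using s by (simp add: cayley_def field_simps)
  then have "ln (1 - cayley s) = ln s + ln (1 + cayley s)"
    using cayley_bounds[OF s] s by (simp add: ln_mult)
  ultimately show ?thesis by simp
qed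

lemma ps_nest_arctan:
  assumes s: "0 < s" "s < 1"
  shows "ps (nest (-1) (replicate r 1)) (cayley s) = (pi / 2 - 2 * arctan s) ^ r / fact r"
proof -
  have "ps (nest (-1) (replicate r 1)) (cayley s) = (2 * arctan (cayley s)) ^ r / fact r"
  proof (rule ps_nest_replicate)
    fix x :: real
    have "((\<lambda>x. 2 * arctan x) has_real_derivative 2 * inverse (1 + x\<^sup>2)) (at x)"
      by (intro DERIV_cmult DERIV_arctan)
    then show "((\<lambda>x. 2 * arctan x) has_real_derivative 2 / (1 - - 1 * x\<^sup>2)) (at x)"
      by (simp add: divide_inverse)
  qed (use cayley_bounds[OF s] in auto)
  moreover have "arctan 1 + arctan (- s) = arctan ((1 + - s) / (1 - 1 * - s))"
    using s by (intro arctan_add) auto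
  then have "2 * arctan (cayley s) = pi / 2 - 2 * arctan s"
    by (simp add: arctan_one arctan_minus cayley_def)
  ultimately show ?thesis by (simp only:)
qed

text \<open>A truncated form of \<open>ps_csum\<close>: multiplying by \<open>1 + x^2\<close>
  telescopes up to the two terms of highest degree.\<close>

lemma csum_alternating_partial_sum:
  "(1 + x\<^sup>2) * (\<Sum>k<Suc (Suc n). csum (-1) a k * x ^ k) =
     (\<Sum>k<Suc (Suc n). a k * x ^ k)
       + csum (-1) a n * x ^ n * x\<^sup>2 + csum (-1) a (Suc n) * x ^ Suc n * x\<^sup>2"
proof (induction n)
  case 0
  show ?case by (simp add: power2_eq_square algebra_simps)
next
  case (Suc n)
  have "(1 + x\<^sup>2) * (\<Sum>k<Suc (Suc (Suc n)). csum (-1) a k * x ^ k) =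
      (1 + x\<^sup>2) * (\<Sum>k<Suc (Suc n). csum (-1) a k * x ^ k) + (1 + x\<^sup>2) * (csum (-1) a (Suc (Suc n)) * x ^ Suc (Suc n))"
    by (simp only: sum.lessThan_Suc[of _ "Suc (Suc n)"] distrib_left)
  also have "\<dots> = (\<Sum>k<Suc (Suc n). a k * x ^ k) + a (Suc (Suc n)) * x ^ Suc (Suc n)
       + csum (-1) a (Suc n) * x ^ Suc n * x\<^sup>2 + csum (-1) a (Suc (Suc n)) * x ^ Suc (Suc n) * x\<^sup>2"
    unfolding Suc.IH by (simp add: power2_eq_square algebra_simps)
  finally show ?case
    by (simp only: sum.lessThan_Suc[of _ "Suc (Suc n)"])
qed

text \<open>Termwise absolute values would lead to the majorant
  \<open>(- ln s) ^ r / fact r / (1 - x^2)\<close>, whose pole at \<open>s = 0\<close> is not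
  integrable. Multiplying by \<open>1 + x^2\<close> first leaves three pieces, each bounded by
  \<open>(- ln s) ^ r / fact r\<close>.\<close>

lemma tsum_partial_sum_le:
  assumes s: "0 < s" "s < 1"
  shows "\<bar>\<Sum>k<Suc (Suc n). tsum (-1) r k * cayley s ^ k\<bar> \<le> 3 * ((- ln s) ^ r / fact r)"
proof -
  define x where "x = cayley s"
  have x: "0 < x" "x < 1" using cayley_bounds[OF s] by (auto simp: x_def)
  define a b where "a = nest (-1) (replicate r 1)" and "b = nest 1 (replicate r 1)"
  define M where "M = (- ln s) ^ r / fact r"
  have rd: "root_decay b" unfolding b_def by (intro root_decay_nest) auto
  have b0: "0 \<le> b k" for k by (simp add: b_def nest_nonneg)
  have ab: "\<bar>a k\<bar> \<le> b k" for k unfolding a_def b_def by (intro nest_abs_le_nest) simp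
  have M: "(\<Sum>k\<in>A. b k * x ^ k) \<le> M" if "finite A" for A
  proof -
    have "(\<Sum>k\<in>A. b k * x ^ k) \<le> (\<Sum>k. b k * x ^ k)"
      using x that b0 rd by (intro sum_le_suminf summable_ps) auto
    also have "\<dots> = M"
      using ps_nest_ln[OF s, of r] by (simp add: ps_def x_def b_def M_def)
    finally show ?thesis .
  qed
  have t: "\<bar>csum (-1) a k * x ^ k * x\<^sup>2\<bar> \<le> M" for k
  proof -
    have "\<bar>csum (-1) a k * x ^ k * x\<^sup>2\<bar> = \<bar>csum (-1) a k\<bar> * x ^ k * x\<^sup>2"
      using x by (simp add: abs_mult)
    also have "\<dots> \<le> csum 1 b k * x ^ k * 1"
      using csum_abs_le_csum[of "-1" a b k] ab x csum_nonneg[of b k] b0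
      by (intro mult_mono power_le_one) auto
    also have "\<dots> \<le> M"
      using csum_mult_power_le[of b x k] b0 x M[of "{..k}"] by simp
    finally show ?thesis .
  qed
  have "\<bar>\<Sum>k<Suc (Suc n). a k * x ^ k\<bar> \<le> (\<Sum>k<Suc (Suc n). b k * x ^ k)"
    by (rule order_trans[OF sum_abs sum_mono]) (use ab x in \<open>auto simp: abs_mult intro!: mult_right_mono\<close>)
  also have "\<dots> \<le> M" by (rule M) simp
  finally have "\<bar>(1 + x\<^sup>2) * (\<Sum>k<Suc (Suc n). csum (-1) a k * x ^ k)\<bar> \<le> 3 * M"
    unfolding csum_alternating_partial_sum using t[of n] t[of "Suc n"] by linarith
  moreover have "1 * \<bar>\<Sum>k<Suc (Suc n). csum (-1) a k * x ^ k\<bar> \<le> \<bar>(1 + x\<^sup>2) * (\<Sum>k<Suc (Suc n). csum (-1) a k * x ^ k)\<bar>"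
    unfolding abs_mult by (intro mult_right_mono) auto
  ultimately show ?thesis by (simp only: tsum_def a_def x_def M_def)
qed

lemma tsum_sums_arctan:
  assumes s: "0 < s" "s < 1"
  shows "(\<lambda>k. tsum (-1) r k * cayley s ^ k) sums
      ((pi / 2 - 2 * arctan s) ^ r / fact r / (1 + (cayley s)\<^sup>2))"
proof -
  have rd: "root_decay (nest (-1) (replicate r 1))" by (intro root_decay_nest) auto
  have c: "\<bar>cayley s\<bar> < 1" using cayley_bounds[OF s] by auto
  have "(1 - -1 * (cayley s)\<^sup>2) * ps (tsum (-1) r) (cayley s) = (pi / 2 - 2 * arctan s) ^ r / fact r"
    unfolding tsum_def ps_nest_arctan[OF s, symmetric] by (rule ps_csum[OF rd _ c]) simp
  moreover have "1 - -1 * (cayley s)\<^sup>2 = 1 + (cayley s)\<^sup>2" "1 + (cayley s)\<^sup>2 \<noteq> 0"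
    by (auto simp: add_nonneg_eq_0_iff)
  ultimately have "ps (tsum (-1) r) (cayley s) = (pi / 2 - 2 * arctan s) ^ r / fact r / (1 + (cayley s)\<^sup>2)"
    by (metis nonzero_mult_div_cancel_left)
  moreover have "(\<lambda>k. tsum (-1) r k * cayley s ^ k) sums ps (tsum (-1) r) (cayley s)"
    unfolding ps_def tsum_def by (intro summable_sums summable_csum[OF rd _ c]) simp
  ultimately show ?thesis by simp
qed

lemma sums_tsum_conv:
  assumes "odd r" "odd q"
  shows "(\<lambda>k. tsum (-1) r k * (2 / real (Suc k)) * tsum_conv q k) sums
           (\<Sum>k. nest_comp (-1) (Suc r) (q + Suc r) k)"
proof -
  define L where "L = (\<lambda>s::real. (- ln s) ^ q / fact q)"
  define w where "w = (\<lambda>s::real. 2 / (1 + s)\<^sup>2)"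
  define c where "c = (\<lambda>k. tsum (-1) r k * (2 / real (Suc k)) * tsum_conv q k)"
  define f where "f = (\<lambda>n s. (\<Sum>k<Suc (Suc n). tsum (-1) r k * cayley s ^ k) * (2 * L s * w s))"
  define g where "g = (\<lambda>s. (- ln s) ^ q / fact q * ((pi / 2 - 2 * arctan s) ^ r / fact r) * (2 / (1 + s\<^sup>2)))"
  have trm: "((\<lambda>s. tsum (-1) r k * cayley s ^ k * (2 * L s * w s)) has_integral c k) {0<..<1}" for k
  proof (cases "even (k + q)")
    case True
    have "((\<lambda>s. tsum (-1) r k * (2 / real (Suc k)) * (real (Suc k) * cayley s ^ k * L s * w s)) has_integral c k) {0<..<1}"
      unfolding c_def L_def w_def
      by (rule has_integral_mult_right) (rule has_integral_cayley_power[OF True])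
    moreover have "tsum (-1) r k * (2 / real (Suc k)) * (real (Suc k) * cayley s ^ k * L s * w s)
        = tsum (-1) r k * cayley s ^ k * (2 * L s * w s)" for s
      by (simp del: of_nat_Suc)
    ultimately show ?thesis by (simp only:)
  next
    case False
    \<comment> \<open>As \<open>r\<close> and \<open>q\<close> are both odd, the moments not covered
      by \<open>has_integral_cayley_power\<close> have coefficient 0.\<close>
    then have "tsum (-1) r k = 0" using assms by (intro tsum_parity) auto
    then show ?thesis by (simp add: c_def)
  qed
  have fi: "(f n has_integral (\<Sum>k<Suc (Suc n). c k)) {0<..<1}" for n
    unfolding f_def sum_distrib_right by (intro has_integral_sum trm) auto
  \<comment> \<open>The constants rewrite the majorant as a multiple of the integrand for
    \<open>zetabar (r + q)\<close>.\<close>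
  have "(\<lambda>s::real. 3 / fact r * (2 / fact q) * (2 * fact (r + q)) *
      ((- ln s) ^ (r + q) / fact (r + q) * (1 / (1 + s)\<^sup>2))) integrable_on {0<..<1}"
    by (intro integrable_on_mult_right has_integral_integrable[OF has_integral_ln_power_zetabar])
  moreover have "3 / fact r * (2 / fact q) * (2 * fact (r + q)) *
      ((- ln s) ^ (r + q) / fact (r + q) * (1 / (1 + s)\<^sup>2))
      = 3 * ((- ln s) ^ r / fact r) * (2 * L s * w s)" for s :: real
    by (simp add: L_def w_def power_add)
  ultimately have h: "(\<lambda>s. 3 * ((- ln s) ^ r / fact r) * (2 * L s * w s)) integrable_on {0<..<1}"
    by (simp only:)
  have fi': "f n integrable_on {0<..<1}" for n
    using fi by (rule has_integral_integrable)
  have bound: "norm (f n s) \<le> 3 * ((- ln s) ^ r / fact r) * (2 * L s * w s)"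
    if "s \<in> {0<..<1}" for n s
  proof -
    have s: "0 < s" "s < 1" using that by auto
    have "0 \<le> 2 * L s * w s"
      using s by (auto simp: L_def w_def)
    then show "norm (f n s) \<le> 3 * ((- ln s) ^ r / fact r) * (2 * L s * w s)"
      unfolding f_def real_norm_def abs_mult[of "sum _ _"]
      using tsum_partial_sum_le[OF s, of r n] by (intro mult_mono) auto
  qed
  have lim: "(\<lambda>n. f n s) \<longlonglongrightarrow> g s" if "s \<in> {0<..<1}" for s
  proof -
    have s: "0 < s" "s < 1" using that by auto
    have "(\<lambda>n. \<Sum>k<n. tsum (-1) r k * cayley s ^ k) \<longlonglongrightarrow>
        (pi / 2 - 2 * arctan s) ^ r / fact r / (1 + (cayley s)\<^sup>2)"
      using tsum_sums_arctan[OF s] by (simp add: sums_def)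
    from LIMSEQ_Suc[OF LIMSEQ_Suc[OF this]]
    have "(\<lambda>n. f n s) \<longlonglongrightarrow> (pi / 2 - 2 * arctan s) ^ r / fact r / (1 + (cayley s)\<^sup>2) * (2 * L s * w s)"
      unfolding f_def by (intro tendsto_mult tendsto_const)
    \<comment> \<open>The weight in \<open>x\<close> turns into the weight of the arctangent in
      \<open>s\<close>.\<close>
    moreover have "w s / (1 + (cayley s)\<^sup>2) = 1 / (1 + s\<^sup>2)"
    proof -
      have "(1 + s)\<^sup>2 * (cayley s)\<^sup>2 = (1 - s)\<^sup>2"
        using s by (simp add: cayley_def power_divide)
      then have "(1 + s)\<^sup>2 * (1 + (cayley s)\<^sup>2) = (1 + s)\<^sup>2 + (1 - s)\<^sup>2"
        by (simp add: distrib_left)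
      also have "\<dots> = 2 * (1 + s\<^sup>2)"
        by (simp add: power2_eq_square algebra_simps)
      finally have eq: "(1 + s)\<^sup>2 * (1 + (cayley s)\<^sup>2) = 2 * (1 + s\<^sup>2)" .
      have "2 / (2 * y) = 1 / y" for y :: real by simp
      then show ?thesis unfolding w_def divide_divide_eq_left eq .
    qed
    moreover have "(pi / 2 - 2 * arctan s) ^ r / fact r / (1 + (cayley s)\<^sup>2) * (2 * L s * w s)
        = (pi / 2 - 2 * arctan s) ^ r / fact r * (2 * L s) * (w s / (1 + (cayley s)\<^sup>2))"
      by simp
    moreover have "(pi / 2 - 2 * arctan s) ^ r / fact r * (2 * L s) * (1 / (1 + s\<^sup>2)) = g s"
      by (simp add: g_def L_def mult_ac)
    ultimately show "(\<lambda>n. f n s) \<longlonglongrightarrow> g s" by (simp only:)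
  qed
  have "(\<lambda>n. \<Sum>k<Suc (Suc n). c k) \<longlonglongrightarrow> integral {0<..<1} g"
    using dominated_convergence(2)[OF fi' h bound lim] by (simp only: integral_unique[OF fi])
  moreover have "integral {0<..<1} g = (\<Sum>k. nest_comp (-1) (Suc r) (q + Suc r) k)"
    unfolding g_def by (rule integral_unique[OF has_integral_ln_arctan_powers])
  ultimately have "(\<lambda>n. \<Sum>k<n. c k) \<longlonglongrightarrow> (\<Sum>k. nest_comp (-1) (Suc r) (q + Suc r) k)"
    using LIMSEQ_offset[of "\<lambda>n. \<Sum>k<n. c k" 2] by (simp del: sum.lessThan_Suc)
  then show ?thesis by (simp add: sums_def c_def)
qed

section \<open>The finite sums T\<close>

text \<open>The gaps \<open>d\<close> are alternately 0 and 1 for \<open>T_chains\<close> and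
  constantly 1 for \<open>Tbar\<close>.\<close>

definition step_chains :: "(nat \<Rightarrow> nat) \<Rightarrow> nat \<Rightarrow> nat \<Rightarrow> nat list set" where
  "step_chains d r n = {ns. length ns = r \<and> (\<forall>i<r. 0 < ns ! i \<and> ns ! i \<le> n) \<and>
      (\<forall>i. Suc i < r \<longrightarrow> ns ! i + d i \<le> ns ! Suc i)}"

definition chain_sum :: "(nat \<Rightarrow> nat) \<Rightarrow> (nat \<Rightarrow> nat \<Rightarrow> real) \<Rightarrow> nat \<Rightarrow> nat \<Rightarrow> real" where
  "chain_sum d f r n = (\<Sum>ns\<in>step_chains d r n. \<Prod>i<r. f i (ns ! i))"

lemma finite_step_chains: "finite (step_chains d r n)"
proof (rule finite_subset)
  show "step_chains d r n \<subseteq> {ns. set ns \<subseteq> {..n} \<and> length ns = r}"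
    by (auto simp: step_chains_def set_conv_nth)
qed (rule finite_lists_length_eq, simp)

lemma chain_sum_0: "chain_sum d f 0 n = 1"
proof -
  have "step_chains d 0 n = {[]}" by (auto simp: step_chains_def)
  then show ?thesis by (simp add: chain_sum_def)
qed

text \<open>The chain increases weakly, so the last gap bounds all earlier entries. Truncated
  subtraction does no harm: a bound 0 excludes every positive entry, and for \<open>r = 0\<close>
  only \<open>[]\<close> remains, whatever the bound.\<close>

lemma append_in_step_chains_iff:
  "ns @ [l] \<in> step_chains d (Suc r) n \<longleftrightarrow> 0 < l \<and> l \<le> n \<and> ns \<in> step_chains d r (l - d (r - 1))"
proof
  assume A: "ns @ [l] \<in> step_chains d (Suc r) n"
  then have len: "length ns = r" by (simp add: step_chains_def)
  have l: "0 < l" "l \<le> n" using A len by (auto simp: step_chains_def nth_append dest: spec[of _ r])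
  have step: "ns ! i + d i \<le> ns ! Suc i" if "Suc i < r" for i
    using A len that by (auto simp: step_chains_def nth_append dest!: spec[of _ i])
  have last: "ns ! (r - 1) + d (r - 1) \<le> l" if "0 < r"
    using A len that by (auto simp: step_chains_def nth_append dest!: spec[of _ "r - 1"])
  have "sorted ns"
    unfolding sorted_iff_nth_Suc using step len by (metis add_leD1)
  have "ns ! i \<le> l - d (r - 1)" if i: "i < r" for i
  proof -
    have "ns ! i \<le> ns ! (r - 1)"
      using \<open>sorted ns\<close> len i by (intro sorted_nth_mono) auto
    moreover have "ns ! (r - 1) + d (r - 1) \<le> l" using last i by simp
    ultimately show ?thesis by linarith
  qed
  moreover have "0 < ns ! i" if "i < r" for i
    using A len that by (auto simp: step_chains_def nth_append dest!: spec[of _ i])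
  ultimately show "0 < l \<and> l \<le> n \<and> ns \<in> step_chains d r (l - d (r - 1))"
    using l len step by (auto simp: step_chains_def)
next
  assume A: "0 < l \<and> l \<le> n \<and> ns \<in> step_chains d r (l - d (r - 1))"
  then have len: "length ns = r" by (simp add: step_chains_def)
  have B: "0 < ns ! i \<and> ns ! i \<le> l - d (r - 1)" if "i < r" for i
    using A that by (auto simp: step_chains_def)
  show "ns @ [l] \<in> step_chains d (Suc r) n"
    unfolding step_chains_def
  proof (intro CollectI conjI allI impI)
    fix i assume i: "Suc i < Suc r"
    show "(ns @ [l]) ! i + d i \<le> (ns @ [l]) ! Suc i"
    proof (cases "Suc i < r")
      case True
      then show ?thesis using A len by (auto simp: step_chains_def nth_append)
    next
      case False
      then have "Suc i = r" using i by simp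
      then show ?thesis using B[of i] len by (auto simp: nth_append)
    qed
  next
    fix i assume i: "i < Suc r"
    then show "0 < (ns @ [l]) ! i" "(ns @ [l]) ! i \<le> n"
      using A B[of i] len by (cases "i = r"; force simp: nth_append)+
  qed (use len in simp)
qed

lemma step_chains_Suc:
  "step_chains d (Suc r) n = (\<lambda>(l, ns). ns @ [l]) ` (SIGMA l:{1..n}. step_chains d r (l - d (r - 1)))"
proof (intro equalityI subsetI)
  fix ms assume A: "ms \<in> step_chains d (Suc r) n"
  then have "ms \<noteq> []" by (auto simp: step_chains_def)
  then have "ms = butlast ms @ [last ms]" by simp
  moreover from this A have "0 < last ms \<and> last ms \<le> n \<and> butlast ms \<in> step_chains d r (last ms - d (r - 1))"
    using append_in_step_chains_iff[of "butlast ms" "last ms"] by simp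
  ultimately show "ms \<in> (\<lambda>(l, ns). ns @ [l]) ` (SIGMA l:{1..n}. step_chains d r (l - d (r - 1)))"
    by (intro image_eqI[of _ _ "(last ms, butlast ms)"]) auto
qed (auto simp: append_in_step_chains_iff)

lemma chain_sum_Suc:
  "chain_sum d f (Suc r) n = (\<Sum>l=1..n. f r l * chain_sum d f r (l - d (r - 1)))"
proof -
  have "inj_on (\<lambda>(l, ns). ns @ [l]) (SIGMA l:{1..n}. step_chains d r (l - d (r - 1)))"
    by (auto simp: inj_on_def)
  then have "chain_sum d f (Suc r) n =
      (\<Sum>(l, ns)\<in>(SIGMA l:{1..n}. step_chains d r (l - d (r - 1))). \<Prod>i<Suc r. f i ((ns @ [l]) ! i))"
    unfolding chain_sum_def step_chains_Suc by (subst sum.reindex) (auto simp: case_prod_unfold)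
  also have "\<dots> = (\<Sum>l=1..n. \<Sum>ns\<in>step_chains d r (l - d (r - 1)). \<Prod>i<Suc r. f i ((ns @ [l]) ! i))"
    by (subst sum.Sigma) (auto simp: finite_step_chains)
  also have "\<dots> = (\<Sum>l=1..n. \<Sum>ns\<in>step_chains d r (l - d (r - 1)). f r l * (\<Prod>i<r. f i (ns ! i)))"
    by (intro sum.cong refl) (simp add: step_chains_def nth_append)
  finally show ?thesis by (simp add: chain_sum_def sum_distrib_left)
qed

lemma tsum_eq_sum_odd:
  "(\<Sum>l=1..n. 2 / (2 * real l - 1) * tsum 1 r (2 * (l - 1))) = tsum 1 (Suc r) (2 * n - 1)"
proof (induction n)
  case (Suc n)
  show ?case
  proof (cases n)
    case 0
    then show ?thesis by (simp add: tsum_Suc_1)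
  next
    case k: (Suc k)
    have "2 * real (Suc n) - 1 = real (Suc (Suc (2 * k + 1)))" "2 * (Suc n - 1) = Suc (2 * k + 1)"
      "2 * n - 1 = 2 * k + 1" "2 * Suc n - 1 = Suc (Suc (2 * k + 1))"
      using k by simp_all
    moreover have "(\<Sum>l=1..Suc n. 2 / (2 * real l - 1) * tsum 1 r (2 * (l - 1))) =
      tsum 1 (Suc r) (2 * n - 1) + 2 / (2 * real (Suc n) - 1) * tsum 1 r (2 * (Suc n - 1))"
      by (subst sum.nat_ivl_Suc') (simp_all only: Suc.IH add.commute)
    ultimately show ?thesis by (simp only: tsum_Suc_Suc_Suc mult_1)
  qed
qed simp

lemma tsum_eq_sum_even:
  "(\<Sum>l=1..n. 2 / (2 * real l) * tsum 1 r (2 * l - 1)) = tsum 1 (Suc r) (2 * n)"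
proof (induction n)
  case (Suc n)
  have "(\<Sum>l=1..Suc n. 2 / (2 * real l) * tsum 1 r (2 * l - 1)) =
      tsum 1 (Suc r) (2 * n) + 2 / (2 * real (Suc n)) * tsum 1 r (2 * Suc n - 1)"
    by (subst sum.nat_ivl_Suc') (simp_all only: Suc.IH add.commute)
  moreover have "2 * real (Suc n) = real (Suc (Suc (2 * n)))" "2 * Suc n - 1 = Suc (2 * n)"
      "2 * Suc n = Suc (Suc (2 * n))"
    by simp_all
  ultimately show ?case by (simp only: tsum_Suc_Suc_Suc mult_1)
qed simp

text \<open>With \<open>N = 2 n - 1\<close> or \<open>N = 2 n\<close> in alternating positions, the
  weak and strict inequalities both become strict ones between the \<open>N\<close> of alternating
  parity.\<close>

lemma chain_sum_eq_tsum:
  "chain_sum (\<lambda>i. if even i then 0 else 1) (\<lambda>i n. 2 / (if even i then 2 * real n - 1 else 2 * real n)) r n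
     = tsum 1 r (if odd r then 2 * n - 1 else 2 * n)"
proof (induction r arbitrary: n)
  case 0
  have "tsum 1 0 (2 * n) = 1"
    by (induction n) (simp_all add: tsum_0_Suc_Suc)
  then show ?case by (simp add: chain_sum_0)
next
  case (Suc r)
  let ?d = "\<lambda>i::nat. if even i then 0 else 1 :: nat"
  let ?f = "\<lambda>i n. 2 / (if even i then 2 * real n - 1 else 2 * real n)"
  show ?case
  proof (cases "odd r")
    case True
    then have "?d (r - 1) = 0" by simp
    then show ?thesis
      unfolding chain_sum_Suc Suc.IH using True tsum_eq_sum_even[of r n] by simp
  next
    case False
    \<comment> \<open>For \<open>r = 0\<close> the truncated \<open>r - 1\<close> selects gap 0
      instead of 1, but the empty chain contributes 1 for every bound.\<close>
    have *: "chain_sum ?d ?f r (l - ?d (r - 1)) = tsum 1 r (2 * (l - 1))" for l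
    proof (cases r)
      case 0
      have "tsum 1 0 (2 * k) = 1" for k
        by (induction k) (simp_all add: tsum_0_Suc_Suc)
      then show ?thesis using 0 by (simp add: chain_sum_0)
    next
      case (Suc k)
      then show ?thesis using False Suc.IH by simp
    qed
    show ?thesis
      unfolding chain_sum_Suc * using False tsum_eq_sum_odd[of r n] by simp
  qed
qed

lemma T_ones_eq_tsum: "T_ones (Suc n) (Suc a) = tsum 1 (2 * a + 1) (2 * n + 1)"
proof -
  let ?d = "\<lambda>i::nat. if even i then 0 else 1 :: nat"
  let ?f = "\<lambda>i n. 2 / (if even i then 2 * real n - 1 else 2 * real n)"
  have "T_chains (Suc n) (Suc a) = step_chains ?d (2 * a + 1) (Suc n)"
    by (auto simp: T_chains_def step_chains_def)
  then have "T_ones (Suc n) (Suc a) = chain_sum ?d ?f (2 * a + 1) (Suc n)"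
    unfolding T_ones_def chain_sum_def
    by (intro sum.cong) (auto simp: step_chains_def prod_dividef simp del: prod.lessThan_Suc)
  also have "\<dots> = tsum 1 (2 * a + 1) (2 * n + 1)"
    unfolding chain_sum_eq_tsum by simp
  finally show ?thesis .
qed

section \<open>The series W and the inversion by Z\<close>

lemma csum_eq_0: "(\<And>j. j \<le> k \<Longrightarrow> a j = 0) \<Longrightarrow> csum e a k = 0"
  by (induction k rule: induct_nat_012) auto

lemma nest_eq_0_of_less: "k < length cs \<Longrightarrow> nest e cs k = 0"
proof (induction cs arbitrary: k)
  case (Cons c cs)
  show ?case
  proof (cases k)
    case (Suc j)
    then have "csum e (nest e cs) j = 0" using Cons by (intro csum_eq_0) auto
    then show ?thesis using Suc by simp
  qed simp
qed simp

text \<open>For \<open>k\<close> and \<open>L\<close> of the same parity the sign is \<open>(-1) ^ ((k - L) / 2)\<close>, written without subtraction.\<close>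

lemma csum_sign:
  assumes "\<And>k. a k = (-1) ^ ((k + L) div 2 + L) * b k"
  shows "csum (-1) a k = (-1) ^ ((k + L) div 2 + L) * csum 1 b k"
  by (induction k rule: induct_nat_012) (simp_all add: assms algebra_simps)

lemma nest_sign: "nest (-1) cs k = (-1) ^ ((k + length cs) div 2 + length cs) * nest 1 cs k"
proof (induction cs arbitrary: k)
  case (Cons c cs)
  show ?case
  proof (cases k)
    case (Suc j)
    have "csum (-1) (nest (-1) cs) j = (-1) ^ ((j + length cs) div 2 + length cs) * csum 1 (nest 1 cs) j"
      by (rule csum_sign) (rule Cons.IH)
    then show ?thesis using Suc by (simp del: of_nat_Suc)
  qed simp
qed simp

lemma tsum_sign: "tsum (-1) r k = (-1) ^ ((k + r) div 2 + r) * tsum 1 r k"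
  unfolding tsum_def using nest_sign[of "replicate r 1"] by (intro csum_sign) simp

text \<open>For small \<open>l\<close> the truncated index is 0, where \<open>nest\<close> vanishes
  on a nonempty list.\<close>

lemma sum_nest_eq_csum:
  assumes "0 < length cs"
  shows "(\<Sum>l=1..B. nest 1 cs (2 * l - length cs)) = csum 1 (nest 1 cs) (2 * B - length cs)"
proof (induction B)
  case 0
  then show ?case using assms nest_eq_0_of_less[of 0 cs] by simp
next
  case (Suc B)
  have 0: "nest 1 cs 0 = 0" using assms by (intro nest_eq_0_of_less)
  have "csum 1 (nest 1 cs) (2 * Suc B - length cs)
      = csum 1 (nest 1 cs) (2 * B - length cs) + nest 1 cs (2 * Suc B - length cs)"
  proof (cases "length cs \<le> 2 * B")
    case True
    then have "2 * Suc B - length cs = Suc (Suc (2 * B - length cs))" by simp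
    then show ?thesis by simp
  next
    case False
    then have "2 * B - length cs = 0" "2 * Suc B - length cs \<in> {0, Suc 0}" by auto
    then show ?thesis using 0 by auto
  qed
  then show ?case using Suc.IH by (subst sum.nat_ivl_Suc') simp_all
qed

text \<open>If \<open>l \<le> r\<close>, no chain of \<open>Suc r\<close> increasing positive
  integers ends at \<open>l\<close> and both sides vanish. This also removes truncated indices and
  denominators that are not positive.\<close>

lemma nest_step:
  assumes S: "2 ^ r * S = csum 1 (nest 1 cs) (2 * (l - 1) - r)" and len: "length cs = r" and l: "1 \<le> l"
  shows "2 ^ Suc r * (1 / (2 * real l - real (Suc r)) ^ c * S) = nest 1 (c # cs) (2 * l - Suc r)"
proof (cases "r < l")
  case True
  have "2 ^ Suc r * (1 / (2 * real l - real (Suc r)) ^ c * S) =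
      2 * (1 / (2 * real l - real (Suc r)) ^ c) * csum 1 (nest 1 cs) (2 * (l - 1) - r)"
    unfolding S[symmetric] by simp
  moreover have "2 * l - Suc r = Suc (2 * (l - 1) - r)" using True by simp
  moreover have "real (2 * l - Suc r) = 2 * real l - real (Suc r)"
    using True by (subst of_nat_diff) auto
  ultimately show ?thesis
    by (simp del: of_nat_Suc)
next
  case False
  have "csum 1 (nest 1 cs) (2 * (l - 1) - r) = 0"
    using False l len by (intro csum_eq_0 nest_eq_0_of_less) auto
  moreover have "nest 1 (c # cs) (2 * l - Suc r) = 0"
    using False len by (intro nest_eq_0_of_less) auto
  ultimately show ?thesis using S by simp
qed

abbreviation Tbar_factor :: "nat list \<Rightarrow> nat \<Rightarrow> nat \<Rightarrow> real" where
  "Tbar_factor ks i n \<equiv> 1 / (2 * real n - real (Suc i)) ^ (ks ! i)"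

lemma chain_sum_eq_csum:
  assumes "r \<le> length ks"
  shows "2 ^ r * chain_sum (\<lambda>_. 1) (Tbar_factor ks) r B = csum 1 (nest 1 (rev (take r ks))) (2 * B - r)"
  using assms
proof (induction r arbitrary: B)
  case 0
  have "csum 1 (nest 1 []) (2 * B) = 1" by (induction B) auto
  then show ?case by (simp add: chain_sum_0)
next
  case (Suc r)
  let ?cs = "rev (take r ks)"
  have cs: "rev (take (Suc r) ks) = ks ! r # ?cs"
    using Suc.prems by (simp add: take_Suc_conv_app_nth)
  have len: "length ?cs = r" using Suc.prems by simp
  have "2 ^ Suc r * chain_sum (\<lambda>_. 1) (Tbar_factor ks) (Suc r) B =
      (\<Sum>l=1..B. 2 ^ Suc r * (Tbar_factor ks r l * chain_sum (\<lambda>_. 1) (Tbar_factor ks) r (l - 1)))"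
    by (simp only: chain_sum_Suc sum_distrib_left)
  also have "\<dots> = (\<Sum>l=1..B. nest 1 (ks ! r # ?cs) (2 * l - Suc r))"
    using Suc len by (intro sum.cong nest_step) auto
  also have "\<dots> = csum 1 (nest 1 (ks ! r # ?cs)) (2 * B - Suc r)"
    using sum_nest_eq_csum[of "ks ! r # ?cs" B] len by (simp del: nest.simps)
  finally show ?case by (simp only: cs)
qed

lemma Tbar_inner_eq_nest:
  assumes "ks \<noteq> []"
  shows "2 ^ length ks * Tbar_inner ks N = (-1) ^ N * nest 1 (rev ks) (2 * N - length ks)"
proof -
  obtain r where r: "length ks = Suc r" using assms by (cases ks) auto
  let ?A = "{ns. length ns = length ks \<and> sorted_wrt (<) ns \<and>
        (\<forall>i<length ns. 0 < ns!i) \<and> ns \<noteq> [] \<and> last ns = N}"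
  have rev: "rev ks = ks ! r # rev (take r ks)"
    using take_Suc_conv_app_nth[of r ks] r by simp
  show ?thesis
  proof (cases "N = 0")
    case True
    have "?A = {}"
    proof (rule equals0I)
      fix ns assume ns: "ns \<in> ?A"
      then have "length ns - 1 < length ns" by (auto intro!: diff_less)
      then have "0 < ns ! (length ns - 1)" using ns by blast
      moreover have "ns \<noteq> []" "last ns = 0" using ns True by auto
      ultimately show False by (simp add: last_conv_nth)
    qed
    then have "Tbar_inner ks N = 0" by (simp only: Tbar_inner_def sum.empty)
    moreover have "nest 1 (rev ks) (2 * N - length ks) = 0"
      using True assms by (intro nest_eq_0_of_less) auto
    ultimately show ?thesis by simp
  next
    case False
    have "?A = (\<lambda>ns. ns @ [N]) ` step_chains (\<lambda>_. 1) r (N - 1)"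
    proof (intro equalityI subsetI)
      fix ms assume ms: "ms \<in> ?A"
      then have len: "length ms = Suc r" and ord: "sorted_wrt (<) ms" and pos: "\<forall>i<length ms. 0 < ms ! i"
        and "ms \<noteq> []" and last: "last ms = N"
        using r by auto
      then have eq: "ms = butlast ms @ [N]"
        using append_butlast_last_id by metis
      have "ms ! i \<le> N" if "i < Suc r" for i
      proof -
        have "sorted ms" using ord by (simp add: strict_sorted_iff)
        then have "ms ! i \<le> ms ! (length ms - 1)"
          using that len by (intro sorted_nth_mono) auto
        then show ?thesis using last \<open>ms \<noteq> []\<close> by (simp add: last_conv_nth)
      qed
      then have "ms \<in> step_chains (\<lambda>_. 1) (Suc r) N"
        using len ord pos by (auto simp: step_chains_def sorted_wrt_iff_nth_Suc_transp Suc_le_eq)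
      then have "butlast ms \<in> step_chains (\<lambda>_. 1) r (N - 1)"
        using append_in_step_chains_iff[of "butlast ms" N "\<lambda>_. 1" r N] eq by simp
      then show "ms \<in> (\<lambda>ns. ns @ [N]) ` step_chains (\<lambda>_. 1) r (N - 1)"
        using eq by (intro image_eqI[of _ _ "butlast ms"])
    next
      fix ms assume "ms \<in> (\<lambda>ns. ns @ [N]) ` step_chains (\<lambda>_. 1) r (N - 1)"
      then obtain ns where ns: "ns \<in> step_chains (\<lambda>_. 1) r (N - 1)" "ms = ns @ [N]" by blast
      then have "ms \<in> step_chains (\<lambda>_. 1) (Suc r) N"
        using False by (simp add: append_in_step_chains_iff)
      then show "ms \<in> ?A"
        using ns(2) r by (auto simp: step_chains_def sorted_wrt_iff_nth_Suc_transp Suc_le_eq)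
    qed
    moreover have "inj_on (\<lambda>ns. ns @ [N]) (step_chains (\<lambda>_. 1) r (N - 1))"
      by (auto simp: inj_on_def)
    ultimately have "Tbar_inner ks N = (\<Sum>ns\<in>step_chains (\<lambda>_. 1) r (N - 1).
        (-1) ^ N / (\<Prod>j<length ks. (2 * real ((ns @ [N]) ! j) - real (Suc j)) ^ (ks ! j)))"
      unfolding Tbar_inner_def by (simp only: sum.reindex o_def)
    also have "\<dots> = (\<Sum>ns\<in>step_chains (\<lambda>_. 1) r (N - 1).
        (-1) ^ N * Tbar_factor ks r N * (\<Prod>i<r. Tbar_factor ks i (ns ! i)))"
    proof (rule sum.cong)
      fix ns assume "ns \<in> step_chains (\<lambda>_. 1) r (N - 1)"
      then have "length ns = r" by (simp add: step_chains_def)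
      then have "(\<Prod>j<length ks. (2 * real ((ns @ [N]) ! j) - real (Suc j)) ^ (ks ! j)) =
          (\<Prod>j<r. (2 * real (ns ! j) - real (Suc j)) ^ (ks ! j)) * (2 * real N - real (Suc r)) ^ (ks ! r)"
        unfolding r prod.lessThan_Suc by (simp add: nth_append del: of_nat_Suc)
      then show "(-1) ^ N / (\<Prod>j<length ks. (2 * real ((ns @ [N]) ! j) - real (Suc j)) ^ (ks ! j)) =
          (-1) ^ N * Tbar_factor ks r N * (\<Prod>i<r. Tbar_factor ks i (ns ! i))"
        by (simp add: prod_dividef del: of_nat_Suc)
    qed simp
    also have "\<dots> = (-1) ^ N * (Tbar_factor ks r N * chain_sum (\<lambda>_. 1) (Tbar_factor ks) r (N - 1))"
      by (simp only: chain_sum_def sum_distrib_left mult.assoc)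
    finally have "2 ^ length ks * Tbar_inner ks N =
        (-1) ^ N * (2 ^ Suc r * (Tbar_factor ks r N * chain_sum (\<lambda>_. 1) (Tbar_factor ks) r (N - 1)))"
      by (simp only: r mult.left_commute)
    also have "2 ^ Suc r * (Tbar_factor ks r N * chain_sum (\<lambda>_. 1) (Tbar_factor ks) r (N - 1))
        = nest 1 (ks ! r # rev (take r ks)) (2 * N - Suc r)"
      using False r by (intro nest_step chain_sum_eq_csum) auto
    finally show ?thesis by (simp only: rev r)
  qed
qed

text \<open>For length \<open>2 h\<close> the last index \<open>2 N - 2 h\<close> is even and the
  sign built into \<open>e = -1\<close> is \<open>(-1) ^ N\<close>; the odd coefficients
  vanish.\<close>

lemma Tbar_eq_suminf_nest:
  assumes "ks \<noteq> []" "even (length ks)" "\<forall>c\<in>set ks. 0 < c"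
  shows "Tbar ks = suminf (nest (-1) (rev ks))"
proof -
  define a where "a = nest (-1) (rev ks)"
  obtain h where h: "length ks = 2 * h" using assms by (elim evenE)
  have a0: "a 0 = 0" unfolding a_def using assms by (intro nest_eq_0_of_less) auto
  have inner: "2 ^ length ks * Tbar_inner ks N = a (2 * N - 2 * h)" for N
  proof (cases "h \<le> N")
    case True
    then have "a (2 * N - 2 * h) = (-1) ^ N * nest 1 (rev ks) (2 * N - 2 * h)"
      unfolding a_def nest_sign[of "rev ks"] by (simp add: h power_add power_mult)
    then show ?thesis using Tbar_inner_eq_nest[OF assms(1), of N] by (simp add: h)
  next
    case False
    have "nest 1 (rev ks) 0 = 0" using assms by (intro nest_eq_0_of_less) auto
    then show ?thesis using False Tbar_inner_eq_nest[OF assms(1), of N] by (simp add: h a0)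
  qed
  have "a sums suminf a"
    unfolding a_def using assms by (intro summable_sums summable_nest_alternating) auto
  moreover have "a k = 0" if "k \<notin> range (\<lambda>n. 2 * n)" for k
  proof -
    have "odd k" using that by (metis evenE rangeI)
    then show ?thesis unfolding a_def using assms(2) by (intro nest_parity) auto
  qed
  ultimately have "(\<lambda>n. a (2 * n)) sums suminf a"
    using sums_mono_reindex[of "\<lambda>n. 2 * n" a "suminf a"] by (auto simp: strict_mono_def)
  then have "(\<lambda>n. a (2 * (n + h) - 2 * h)) sums suminf a" by simp
  moreover have "(\<Sum>i<h. a (2 * i - 2 * h)) = 0"
    by (intro sum.neutral) (auto simp: a0)
  ultimately have "(\<lambda>n. a (2 * n - 2 * h)) sums suminf a"
    using sums_iff_shift[of "\<lambda>n. a (2 * n - 2 * h)" h "suminf a"] by (simp add: a0)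
  then have "(\<lambda>N. 2 ^ length ks * Tbar_inner ks N) sums suminf a"
    by (simp only: inner)
  then have "Tbar_inner ks sums (suminf a / 2 ^ length ks)"
    using sums_divide[of "\<lambda>N. 2 ^ length ks * Tbar_inner ks N" "suminf a" "2 ^ length ks"] by simp
  then show ?thesis by (simp add: Tbar_def a_def sums_iff)
qed

lemma W_eq_suminf_nest_comp:
  assumes "even r" "0 < r"
  shows "W n r = suminf (nest_comp (-1) r n)"
proof -
  have "W n r = (\<Sum>ks\<in>Icomp n r. suminf (nest (-1) (rev ks)))"
    unfolding W_def using assms by (intro sum.cong Tbar_eq_suminf_nest) (auto simp: Icomp_iff)
  also have "\<dots> = (\<Sum>cs\<in>Icomp n r. suminf (nest (-1) cs))"
    by (rule sum.reindex_bij_witness[of _ rev rev]) (auto simp: Icomp_iff)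
  also have "\<dots> = suminf (nest_comp (-1) r n)"
    unfolding nest_comp_def by (intro suminf_sum[symmetric] summable_nest_alternating) (auto simp: Icomp_iff)
  finally show ?thesis .
qed

section \<open>Inversion of the convolution with \<open>zetabar\<close>\<close>

definition Z_part :: "nat \<Rightarrow> nat \<Rightarrow> nat \<Rightarrow> real" where
  "Z_part k j p = (-2) ^ k * (\<Sum>is\<in>Zchains k j p. \<Prod>l=1..k. zetabar (2 * (is ! l) - 2 * (is ! (l - 1))))"

lemma Z_part_0: "Z_part 0 j p = (if j = p then 1 else 0)"
proof -
  have "Zchains 0 j p = (if j = p then {[j]} else {})"
    by (auto simp: Zchains_def length_Suc_conv)
  then show ?thesis by (simp add: Z_part_def)
qed

lemma Zchains_Suc:
  "Zchains (Suc k) j p = (\<lambda>(i, is). is @ [p]) ` (SIGMA i:{j..<p}. Zchains k j i)"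
proof (intro equalityI subsetI)
  fix ms assume ms: "ms \<in> Zchains (Suc k) j p"
  define ns where "ns = butlast ms"
  have "ms \<noteq> []" using ms by (auto simp: Zchains_def)
  moreover from this have "last ms = p" using ms by (simp add: Zchains_def last_conv_nth)
  ultimately have eq: "ms = ns @ [p]" unfolding ns_def by (metis append_butlast_last_id)
  have len: "length ns = Suc k" using ms eq by (auto simp: Zchains_def)
  have "sorted_wrt (<) ns" "ns ! k < p" "ns ! 0 = j"
    using ms eq len by (auto simp: Zchains_def sorted_wrt_append nth_append)
  moreover have "ns ! 0 \<le> ns ! k"
    using calculation(1) len by (intro sorted_nth_mono) (auto simp: strict_sorted_iff)
  ultimately have "(ns ! k, ns) \<in> (SIGMA i:{j..<p}. Zchains k j i)"
    using len by (auto simp: Zchains_def)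
  then show "ms \<in> (\<lambda>(i, is). is @ [p]) ` (SIGMA i:{j..<p}. Zchains k j i)"
    using eq by force
next
  fix ms assume "ms \<in> (\<lambda>(i, is). is @ [p]) ` (SIGMA i:{j..<p}. Zchains k j i)"
  then obtain i ns where i: "i < p" and ns: "ns \<in> Zchains k j i" "ms = ns @ [p]" by auto
  have "x \<le> i" if x: "x \<in> set ns" for x
  proof -
    obtain l where "l < Suc k" "x = ns ! l" using x ns by (auto simp: Zchains_def in_set_conv_nth)
    moreover have "sorted ns" using ns by (auto simp: Zchains_def strict_sorted_iff)
    ultimately show ?thesis
      using sorted_nth_mono[of ns l k] ns by (auto simp: Zchains_def)
  qed
  then show "ms \<in> Zchains (Suc k) j p"
    using ns i by (force simp: Zchains_def sorted_wrt_append nth_append)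
qed

lemma finite_Zchains: "finite (Zchains k j p)"
proof (induction k arbitrary: p)
  case 0
  have "Zchains 0 j p \<subseteq> {[j]}" by (auto simp: Zchains_def length_Suc_conv)
  then show ?case using finite_subset by blast
qed (auto simp: Zchains_Suc)

lemma Z_part_Suc: "Z_part (Suc k) j p = (\<Sum>i=j..<p. - 2 * zetabar (2 * p - 2 * i) * Z_part k j i)"
proof -
  let ?P = "\<lambda>k is. \<Prod>l=1..k. zetabar (2 * (is ! l) - 2 * (is ! (l - 1)))"
  have "inj_on (\<lambda>(i, is). is @ [p]) (SIGMA i:{j..<p}. Zchains k j i)"
    by (auto simp: inj_on_def Zchains_def)
  then have "(\<Sum>is\<in>Zchains (Suc k) j p. ?P (Suc k) is) =
      (\<Sum>(i, is)\<in>(SIGMA i:{j..<p}. Zchains k j i). ?P (Suc k) (is @ [p]))"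
    unfolding Zchains_Suc by (subst sum.reindex) (auto simp: case_prod_unfold)
  also have "\<dots> = (\<Sum>i=j..<p. \<Sum>is\<in>Zchains k j i. ?P (Suc k) (is @ [p]))"
    by (subst sum.Sigma) (auto simp: finite_Zchains)
  also have "\<dots> = (\<Sum>i=j..<p. \<Sum>is\<in>Zchains k j i. zetabar (2 * p - 2 * i) * ?P k is)"
  proof (intro sum.cong refl)
    fix i "is" assume "is \<in> Zchains k j i"
    then have len: "length is = Suc k" "is ! k = i" by (auto simp: Zchains_def)
    have "?P k (is @ [p]) = ?P k is"
      using len by (intro prod.cong) (auto simp: nth_append)
    moreover have "?P (Suc k) (is @ [p]) = zetabar (2 * p - 2 * i) * ?P k (is @ [p])"
      using len by (simp add: nth_append)
    ultimately show "?P (Suc k) (is @ [p]) = zetabar (2 * p - 2 * i) * ?P k is" by (simp only:)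
  qed
  finally show ?thesis
    unfolding Z_part_def by (simp add: sum_distrib_left mult_ac)
qed

lemma Z_part_eq_0: "p < j + k \<Longrightarrow> Z_part k j p = 0"
proof (induction k arbitrary: p)
  case (Suc k)
  then show ?case unfolding Z_part_Suc by (intro sum.neutral) auto
qed (simp add: Z_part_0)

text \<open>A cutoff independent of the end point allows the interchange of sums in
  \<open>Z_rec\<close>; the term \<open>k = 0\<close> accounts for \<open>Z p p = 1\<close>.\<close>

lemma Z_eq_sum_Z_part:
  assumes "j \<le> p" "p - j \<le> K"
  shows "Z j p = (\<Sum>k\<le>K. Z_part k j p)"
proof -
  have "(\<Sum>k\<le>K. Z_part k j p) = (\<Sum>k\<le>p - j. Z_part k j p)"
    using assms by (intro sum.mono_neutral_right) (auto intro!: Z_part_eq_0)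
  also have "\<dots> = Z_part 0 j p + (\<Sum>k=1..p - j. Z_part k j p)"
    by (simp add: atMost_atLeast0 sum.atLeast_Suc_atMost)
  also have "\<dots> = Z j p"
    by (auto simp: Z_def Z_part_0) (simp add: Z_part_def)
  finally show ?thesis by simp
qed

lemma Z_rec:
  assumes "j < p"
  shows "Z j p = (\<Sum>i=j..<p. - 2 * zetabar (2 * p - 2 * i) * Z j i)"
proof -
  obtain K where K: "p = Suc K" using assms by (cases p) auto
  have "Z j p = (\<Sum>k\<le>Suc K. Z_part k j p)"
    using assms K by (intro Z_eq_sum_Z_part) auto
  also have "\<dots> = (\<Sum>k\<le>K. Z_part (Suc k) j p)"
    using assms by (simp add: sum.atMost_Suc_shift Z_part_0 del: sum.atMost_Suc)
  also have "\<dots> = (\<Sum>i=j..<p. \<Sum>k\<le>K. - 2 * zetabar (2 * p - 2 * i) * Z_part k j i)"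
    unfolding Z_part_Suc by (rule sum.swap)
  also have "\<dots> = (\<Sum>i=j..<p. - 2 * zetabar (2 * p - 2 * i) * Z j i)"
  proof (intro sum.cong refl)
    fix i assume "i \<in> {j..<p}"
    then have "Z j i = (\<Sum>k\<le>K. Z_part k j i)" using K by (intro Z_eq_sum_Z_part) auto
    then show "(\<Sum>k\<le>K. - 2 * zetabar (2 * p - 2 * i) * Z_part k j i) = - 2 * zetabar (2 * p - 2 * i) * Z j i"
      by (simp only: sum_distrib_left)
  qed
  finally show ?thesis .
qed

text \<open>The triangular system has diagonal \<open>2 * zetabar 0 = 1\<close>. After inserting the
  induction hypothesis and exchanging sums, the coefficient of \<open>D j\<close> is the right-hand
  side of \<open>Z_rec\<close>.\<close>

lemma Z_inversion:
  assumes D: "\<And>j. 1 \<le> j \<Longrightarrow> D j = (\<Sum>i=1..j. 2 * zetabar (2 * j - 2 * i) * y i)" and "1 \<le> p"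
  shows "y p = (\<Sum>j=1..p. Z j p * D j)"
  using \<open>1 \<le> p\<close>
proof (induction p rule: less_induct)
  case (less p)
  have ivl: "{1..p} = insert p {1..<p}" using less.prems by auto
  have "D p = y p + (\<Sum>i=1..<p. 2 * zetabar (2 * p - 2 * i) * y i)"
    unfolding D[OF less.prems] ivl by (simp add: zetabar_def)
  then have "y p = D p + (\<Sum>i=1..<p. - 2 * zetabar (2 * p - 2 * i) * y i)"
    by (simp add: sum_negf)
  also have "(\<Sum>i=1..<p. - 2 * zetabar (2 * p - 2 * i) * y i) =
      (\<Sum>i=1..<p. \<Sum>j=1..i. - 2 * zetabar (2 * p - 2 * i) * (Z j i * D j))"
    using less.IH by (intro sum.cong refl) (simp add: sum_distrib_left)
  also have "\<dots> = (\<Sum>i=1..<p. \<Sum>j | j \<in> {1..<p} \<and> j \<le> i. - 2 * zetabar (2 * p - 2 * i) * (Z j i * D j))"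
    by (intro sum.cong) auto
  also have "\<dots> = (\<Sum>j=1..<p. \<Sum>i | i \<in> {1..<p} \<and> j \<le> i. - 2 * zetabar (2 * p - 2 * i) * (Z j i * D j))"
    by (rule sum.swap_restrict) auto
  also have "\<dots> = (\<Sum>j=1..<p. \<Sum>i=j..<p. - 2 * zetabar (2 * p - 2 * i) * (Z j i * D j))"
    by (intro sum.cong) auto
  also have "\<dots> = (\<Sum>j=1..<p. Z j p * D j)"
    by (intro sum.cong refl) (simp add: Z_rec sum_distrib_right mult.assoc)
  finally show ?case
    unfolding ivl by (simp add: Z_def)
qed

lemma tsum_conv_odd:
  assumes "1 \<le> j"
  shows "tsum_conv (2 * j - 1) (2 * n + 1) = (\<Sum>l=1..j. 2 * zetabar (2 * j - 2 * l) * tsum 1 (2 * l - 1) (2 * n + 1))"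
proof -
  have "{..2 * j - 1} - (\<lambda>l. 2 * l - 1) ` {1..j} \<subseteq> Collect even"
  proof
    fix i assume i: "i \<in> {..2 * j - 1} - (\<lambda>l. 2 * l - 1) ` {1..j}"
    show "i \<in> Collect even"
    proof (rule ccontr)
      assume "i \<notin> Collect even"
      then obtain l where "i = 2 * l + 1" by (auto elim: oddE)
      then show False using i assms by (auto intro!: image_eqI[of _ _ "Suc l"])
    qed
  qed
  then have "tsum_conv (2 * j - 1) (2 * n + 1) =
      (\<Sum>i\<in>(\<lambda>l. 2 * l - 1) ` {1..j}. 2 * zetabar (2 * j - 1 - i) * tsum 1 i (2 * n + 1))"
    unfolding tsum_conv_def
    by (intro sum.mono_neutral_right) (auto simp: tsum_parity)
  also have "\<dots> = (\<Sum>l=1..j. 2 * zetabar (2 * j - 1 - (2 * l - 1)) * tsum 1 (2 * l - 1) (2 * n + 1))"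
    by (subst sum.reindex) (auto simp: inj_on_def)
  also have "\<dots> = (\<Sum>l=1..j. 2 * zetabar (2 * j - 2 * l) * tsum 1 (2 * l - 1) (2 * n + 1))"
  proof (intro sum.cong refl)
    fix l assume "l \<in> {1..j}"
    then have "2 * j - 1 - (2 * l - 1) = 2 * j - 2 * l" by auto
    then show "2 * zetabar (2 * j - 1 - (2 * l - 1)) * tsum 1 (2 * l - 1) (2 * n + 1)
      = 2 * zetabar (2 * j - 2 * l) * tsum 1 (2 * l - 1) (2 * n + 1)" by (simp only:)
  qed
  finally show ?thesis .
qed

text \<open>Only odd \<open>k = 2 n + 1\<close> contribute, and there \<open>2 / (k + 1)\<close> is
  \<open>1 / (n + 1)\<close>. Converting \<open>tsum (-1)\<close> to \<open>tsum 1\<close> produces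
  the alternating sign and \<open>(-1) ^ m\<close>.\<close>

lemma sums_tsum_mult_tsum_conv:
  assumes "1 \<le> m" "1 \<le> j"
  shows "(\<lambda>n. (-1) ^ Suc n * tsum 1 (2 * m - 1) (2 * n + 1) * (tsum_conv (2 * j - 1) (2 * n + 1) / real (Suc n)))
           sums ((-1) ^ m * W (2 * j + 2 * m - 1) (2 * m))"
proof -
  define c where "c = (\<lambda>k. tsum (-1) (2 * m - 1) k * (2 / real (Suc k)) * tsum_conv (2 * j - 1) k)"
  have "c sums (\<Sum>k. nest_comp (-1) (Suc (2 * m - 1)) (2 * j - 1 + Suc (2 * m - 1)) k)"
    unfolding c_def using assms by (intro sums_tsum_conv) auto
  moreover have "Suc (2 * m - 1) = 2 * m" "2 * j - 1 + 2 * m = 2 * j + 2 * m - 1"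
    using assms by auto
  ultimately have "c sums W (2 * j + 2 * m - 1) (2 * m)"
    using assms by (simp add: W_eq_suminf_nest_comp)
  moreover have "c k = 0" if "k \<notin> range (\<lambda>n. 2 * n + 1)" for k
  proof -
    have "even k" using that by (metis oddE rangeI)
    then show ?thesis unfolding c_def using assms by (simp add: tsum_parity)
  qed
  ultimately have "(\<lambda>n. c (2 * n + 1)) sums W (2 * j + 2 * m - 1) (2 * m)"
    using sums_mono_reindex[of "\<lambda>n. 2 * n + 1" c] by (auto simp: strict_mono_def)
  then have "(\<lambda>n. (-1) ^ m * c (2 * n + 1)) sums ((-1) ^ m * W (2 * j + 2 * m - 1) (2 * m))"
    by (rule sums_mult)
  moreover have "(-1) ^ m * c (2 * n + 1) =
      (-1) ^ Suc n * tsum 1 (2 * m - 1) (2 * n + 1) * (tsum_conv (2 * j - 1) (2 * n + 1) / real (Suc n))" for n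
  proof -
    obtain a where m: "m = Suc a" using assms by (cases m) auto
    have e: "(2 * n + 1 + (2 * m - 1)) div 2 + (2 * m - 1) = n + m + (2 * a + 1)"
      by (simp add: m)
    have t: "tsum (-1) (2 * m - 1) (2 * n + 1) = (-1) ^ (n + m + (2 * a + 1)) * tsum 1 (2 * m - 1) (2 * n + 1)"
      unfolding tsum_sign[of "2 * m - 1"] e ..
    have sgn: "(-1::real) ^ m * (-1) ^ (n + m + (2 * a + 1)) = (-1) ^ Suc n"
    proof -
      have "m + (n + m + (2 * a + 1)) = Suc n + 2 * (m + a)" by simp
      then show ?thesis unfolding power_add[symmetric] by (simp add: power_add power_mult)
    qed
    have "2 / real (Suc (2 * n + 1)) = 2 / (2 * real (Suc n))" by simp
    then have half: "2 / real (Suc (2 * n + 1)) = 1 / real (Suc n)"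
      by (simp del: of_nat_Suc)
    have "(-1) ^ m * c (2 * n + 1) = ((-1) ^ m * (-1) ^ (n + m + (2 * a + 1))) * tsum 1 (2 * m - 1) (2 * n + 1)
        * (tsum_conv (2 * j - 1) (2 * n + 1) * (2 / real (Suc (2 * n + 1))))"
      unfolding c_def t by (simp only: mult.assoc mult.commute mult.left_commute)
    then show ?thesis
      unfolding sgn half by simp
  qed
  ultimately show ?thesis by (simp only:)
qed

theorem mainTheorem8:
  fixes m p :: nat
  assumes "1 \<le> m" and "1 \<le> p"
  shows "(\<lambda>n. T_ones (Suc n) m * T_ones (Suc n) p / real (Suc n) * (-1)^(Suc n))
           sums ((-1)^m * (\<Sum>j=1..p. W (2*j + 2*m - 1) (2*m) * Z j p))"
proof -
  define a where "a = (\<lambda>q n. tsum 1 (2 * q - 1) (2 * n + 1))"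
  define D where "D = (\<lambda>j n. tsum_conv (2 * j - 1) (2 * n + 1) / real (Suc n))"
  have T: "T_ones (Suc n) q = a q n" if "1 \<le> q" for q n
    using T_ones_eq_tsum[of n "q - 1"] that by (cases q) (auto simp: a_def)
  \<comment> \<open>The inversion is done for each \<open>n\<close> separately, so afterwards only
    finitely many convergent series are combined.\<close>
  have "a p n / real (Suc n) = (\<Sum>j=1..p. Z j p * D j n)" for n
  proof (rule Z_inversion[where y = "\<lambda>i. a i n / real (Suc n)"])
    fix j :: nat assume "1 \<le> j"
    then show "D j n = (\<Sum>i=1..j. 2 * zetabar (2 * j - 2 * i) * (a i n / real (Suc n)))"
      unfolding D_def a_def tsum_conv_odd[OF \<open>1 \<le> j\<close>] by (simp add: sum_divide_distrib del: of_nat_Suc)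
  qed (rule assms(2))
  then have eq: "T_ones (Suc n) m * T_ones (Suc n) p / real (Suc n) * (-1) ^ Suc n =
      (\<Sum>j=1..p. Z j p * ((-1) ^ Suc n * a m n * D j n))" for n
  proof -
    have "T_ones (Suc n) m * T_ones (Suc n) p / real (Suc n) * (-1) ^ Suc n
        = ((-1) ^ Suc n * a m n) * (a p n / real (Suc n))"
      using T assms by (simp del: of_nat_Suc power_Suc)
    then show ?thesis
      unfolding \<open>a p n / real (Suc n) = _\<close> sum_distrib_left by (simp only: mult.left_commute mult.assoc)
  qed
  have "(\<lambda>n. \<Sum>j=1..p. Z j p * ((-1) ^ Suc n * a m n * D j n)) sums
      (\<Sum>j=1..p. Z j p * ((-1) ^ m * W (2 * j + 2 * m - 1) (2 * m)))"
    unfolding a_def D_def using assms by (intro sums_sum sums_mult sums_tsum_mult_tsum_conv) auto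
  also have "(\<Sum>j=1..p. Z j p * ((-1) ^ m * W (2 * j + 2 * m - 1) (2 * m)))
      = (-1) ^ m * (\<Sum>j=1..p. W (2 * j + 2 * m - 1) (2 * m) * Z j p)"
    by (simp add: sum_distrib_left mult_ac)
  finally show ?thesis by (simp only: eq)
qed

end
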